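(* Let $\gamma:[0,2\pi]\to\mathbb{R}^3$, $\gamma(x)=(\sin x,\cos x,\sin^3 x)$. Then $\gamma$ is a finite type curve, and there exists a plane field $\xi$ such that $\gamma$ is a hyperbolic closed $\xi$-asymptotic line of $\xi$.
   Context: $\mathbb{R}^3$ carries the Euclidean inner product $\langle\cdot,\cdot\rangle$; $\wedge$ denotes the cross product. Finite type curve: a smoothly immersed curve $\gamma$ is of finite type at $x$ if $\{\gamma'(x),\gamma''(x),\dots,\gamma^{(k)}(x)\}$ spans $\mathbb{R}^3$ for some $k\in\mathbb{N}$; it is a finite type curve if this holds at every point. Plane field: a plane field $\xi$ is given by a nonvanishing vector field $\xi:\mathbb{R}^3\to\mathbb{R}^3$ of class $C^k$, $k\ge 3$; the plane at $r$ is $\{dr:\langle\xi(r),dr\rangle=0\}$ (not assumed integrable). A nonzero direction $dr$ at $r$ is a $\xi$-asymptotic direction if $\langle\xi(r),dr\rangle=0$ and $\langle d\xi_r(dr),dr\rangle=0$. A regular curve is a $\xi$-asymptotic line if its tangent vector is a $\xi$-asymptotic direction at each of its points. A point $r$ is parabolic if the two $\xi$-asymptotic directions at $r$ coincide, or if all directions in the plane at $r$ are $\xi$-asymptotic; it is hyperbolic if there are two distinct real $\xi$-asymptotic directions (up to scaling). Poincaré map: let $\gamma=(\gamma_1,\gamma_2,\gamma_3):[0,l]\to\mathbb{R}^3$ be a closed $\xi$-asymptotic line without parabolic points (extended $l$-periodically), with $(\gamma_1',\gamma_2')\ne(0,0)$ and $\gamma_1'\gamma_2''-\gamma_2'\gamma_1''\neq0$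 everywhere. Put $X=\gamma'$, $Y=(\gamma_2',-\gamma_1',0)$, $Z=X\wedge Y$, and use the tubular coordinates $\alpha(x,y,z)=\gamma(x)+yY(x)+zZ(x)$ near $\gamma$. Near $\gamma$ there is a unique continuous field of $\xi$-asymptotic directions that agrees with the direction of $\gamma'$ along $\gamma$. Let $x\mapsto(x,y(x,y_0,z_0),z(x,y_0,z_0))$ be, in the coordinates $(x,y,z)$, the integral curve of this direction field with $(y,z)=(y_0,z_0)$ at $x=0$. The Poincaré map (first return map) is the map $\mathcal{P}(y_0,z_0)=(y(l,y_0,z_0),z(l,y_0,z_0))$, defined for $(y_0,z_0)$ near $(0,0)$; it fixes $(0,0)$. Hyperbolic closed $\xi$-asymptotic line: such a closed $\xi$-asymptotic line $\gamma$ (without parabolic points) is called hyperbolic if no eigenvalue of the derivative $d\mathcal{P}_{(0,0)}$ lies on the unit circle $\mathbb{S}^1\subset\mathbb{C}$. *)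

theory Defs
  imports "HOL-Analysis.Analysis"
begin

section \<open>Curves\<close>

definition curve_deriv :: "nat \<Rightarrow> (real \<Rightarrow> 'a::real_normed_vector) \<Rightarrow> real \<Rightarrow> 'a" where
  "curve_deriv k \<gamma> = ((\<lambda>f x. vector_derivative f (at x)) ^^ k) \<gamma>"

text \<open>Curves are functions on the whole line; a closed curve on the interval from 0 to l
  is represented by its l-periodic extension.\<close>

definition smooth_immersed_curve :: "(real \<Rightarrow> real^3) \<Rightarrow> bool" where
  "smooth_immersed_curve \<gamma> \<longleftrightarrow>
     (\<forall>k x. curve_deriv k \<gamma> differentiable (at x)) \<and> (\<forall>x. curve_deriv 1 \<gamma> x \<noteq> 0)"

definition finite_type_at :: "(real \<Rightarrow> real^3) \<Rightarrow> real \<Rightarrow> bool" where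
  "finite_type_at \<gamma> x \<longleftrightarrow> (\<exists>k. span ((\<lambda>j. curve_deriv j \<gamma> x) ` {1..k}) = UNIV)"

definition finite_type_curve :: "(real \<Rightarrow> real^3) \<Rightarrow> bool" where
  "finite_type_curve \<gamma> \<longleftrightarrow> smooth_immersed_curve \<gamma> \<and> (\<forall>x. finite_type_at \<gamma> x)"

section \<open>Plane fields and asymptotic directions\<close>

fun class_C :: "nat \<Rightarrow> (real^3 \<Rightarrow> real^3) \<Rightarrow> bool" where
  "class_C 0 f \<longleftrightarrow> continuous_on UNIV f"
| "class_C (Suc k) f \<longleftrightarrow> f differentiable_on UNIV \<and>
     (\<forall>i. class_C k (\<lambda>r. frechet_derivative f (at r) (axis i 1)))"

definition plane_field :: "(real^3 \<Rightarrow> real^3) \<Rightarrow> bool" where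
  "plane_field \<xi> \<longleftrightarrow> (\<exists>k\<ge>3. class_C k \<xi>) \<and> (\<forall>r. \<xi> r \<noteq> 0)"

definition asymptotic_direction :: "(real^3 \<Rightarrow> real^3) \<Rightarrow> real^3 \<Rightarrow> real^3 \<Rightarrow> bool" where
  "asymptotic_direction \<xi> r v \<longleftrightarrow>
     v \<noteq> 0 \<and> \<xi> r \<bullet> v = 0 \<and> frechet_derivative \<xi> (at r) v \<bullet> v = 0"

text \<open>The two asymptotic directions (the zeros of a binary quadratic form) coincide iff there is
  exactly one asymptotic direction up to real scaling.\<close>

definition parabolic_point :: "(real^3 \<Rightarrow> real^3) \<Rightarrow> real^3 \<Rightarrow> bool" where
  "parabolic_point \<xi> r \<longleftrightarrow>
     (\<exists>u. asymptotic_direction \<xi> r u \<and> (\<forall>v. asymptotic_direction \<xi> r v \<longrightarrow> (\<exists>c. v = c *\<^sub>R u))) \<or>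
     (\<forall>v. v \<noteq> 0 \<and> \<xi> r \<bullet> v = 0 \<longrightarrow> asymptotic_direction \<xi> r v)"

definition asymptotic_line :: "(real^3 \<Rightarrow> real^3) \<Rightarrow> (real \<Rightarrow> real^3) \<Rightarrow> bool" where
  "asymptotic_line \<xi> \<gamma> \<longleftrightarrow> smooth_immersed_curve \<gamma> \<and>
     (\<forall>x. asymptotic_direction \<xi> (\<gamma> x) (curve_deriv 1 \<gamma> x))"

definition closed_asymptotic_line :: "(real^3 \<Rightarrow> real^3) \<Rightarrow> (real \<Rightarrow> real^3) \<Rightarrow> real \<Rightarrow> bool" where
  "closed_asymptotic_line \<xi> \<gamma> l \<longleftrightarrow>
     0 < l \<and> (\<forall>x. \<gamma> (x + l) = \<gamma> x) \<and> asymptotic_line \<xi> \<gamma>"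

section \<open>The Poincare map\<close>

definition tubular_coordinates :: "(real \<Rightarrow> real^3) \<Rightarrow> real \<Rightarrow> real \<Rightarrow> real \<Rightarrow> real^3" where
  "tubular_coordinates \<gamma> x y z =
     (let X = curve_deriv 1 \<gamma> x;
          Y = vector [X $ 2, - (X $ 1), 0];
          Z = cross3 X Y
      in \<gamma> x + y *\<^sub>R Y + z *\<^sub>R Z)"

text \<open>Standing assumptions under which these coordinates are used.\<close>

definition tubular_admissible :: "(real \<Rightarrow> real^3) \<Rightarrow> bool" where
  "tubular_admissible \<gamma> \<longleftrightarrow>
     (\<forall>x. (curve_deriv 1 \<gamma> x $ 1, curve_deriv 1 \<gamma> x $ 2) \<noteq> (0, 0) \<and>
          curve_deriv 1 \<gamma> x $ 1 * curve_deriv 2 \<gamma> x $ 2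
            - curve_deriv 1 \<gamma> x $ 2 * curve_deriv 2 \<gamma> x $ 1 \<noteq> 0)"

text \<open>A continuous field of asymptotic directions on a neighbourhood U of the curve, agreeing
  with the tangent direction along it.  The line field is represented by a nowhere zero continuous
  vector field D spanning it; near the curve such a D exists, oriented by the tangent
  vector.\<close>

definition asymptotic_field_near ::
    "(real^3 \<Rightarrow> real^3) \<Rightarrow> (real \<Rightarrow> real^3) \<Rightarrow> (real^3) set \<Rightarrow> (real^3 \<Rightarrow> real^3) \<Rightarrow> bool" where
  "asymptotic_field_near \<xi> \<gamma> U D \<longleftrightarrow>
     open U \<and> range \<gamma> \<subseteq> U \<and> continuous_on U D \<and>
     (\<forall>r\<in>U. asymptotic_direction \<xi> r (D r)) \<and>
     (\<forall>x. \<exists>c. D (\<gamma> x) = c *\<^sub>R curve_deriv 1 \<gamma> x)"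

text \<open>The curve x -> (x, y x, z x), in tubular coordinates, is an integral curve of the
  direction field spanned by D: its velocity in space is a nonzero multiple of D.\<close>

definition integral_curve ::
    "(real \<Rightarrow> real^3) \<Rightarrow> (real^3) set \<Rightarrow> (real^3 \<Rightarrow> real^3) \<Rightarrow> real \<Rightarrow>
     (real \<Rightarrow> real) \<Rightarrow> (real \<Rightarrow> real) \<Rightarrow> bool" where
  "integral_curve \<gamma> U D l y z \<longleftrightarrow>
     y differentiable_on {0..l} \<and> z differentiable_on {0..l} \<and>
     (\<forall>x\<in>{0..l}. tubular_coordinates \<gamma> x (y x) (z x) \<in> U \<and>
        (\<exists>s. s \<noteq> 0 \<and>
          ((\<lambda>t. tubular_coordinates \<gamma> t (y t) (z t)) has_vector_derivative
             s *\<^sub>R D (tubular_coordinates \<gamma> x (y x) (z x))) (at x within {0..l})))"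

text \<open>P is a first return map, only its germ at 0 being relevant.  Along a closed asymptotic
  line without parabolic points the direction field is unique and continuously differentiable
  near the curve, so the integral curve starting at a point near 0 is unique and this predicate
  determines the germ of P.\<close>

definition is_poincare_map ::
    "(real^3 \<Rightarrow> real^3) \<Rightarrow> (real \<Rightarrow> real^3) \<Rightarrow> real \<Rightarrow> (real^2 \<Rightarrow> real^2) \<Rightarrow> bool" where
  "is_poincare_map \<xi> \<gamma> l P \<longleftrightarrow>
     (\<exists>U D. asymptotic_field_near \<xi> \<gamma> U D \<and>
        (\<forall>\<^sub>F p in nhds 0. \<exists>y z. integral_curve \<gamma> U D l y z \<and>
            vector [y 0, z 0] = p \<and> P p = vector [y l, z l]))"

definition complex_eigenvalue :: "real^2^2 \<Rightarrow> complex \<Rightarrow> bool" where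
  "complex_eigenvalue A \<mu> \<longleftrightarrow>
     (\<exists>v::complex^2. v \<noteq> 0 \<and> map_matrix complex_of_real A *v v = \<mu> *s v)"

definition hyperbolic_closed_asymptotic_line ::
    "(real^3 \<Rightarrow> real^3) \<Rightarrow> (real \<Rightarrow> real^3) \<Rightarrow> real \<Rightarrow> bool" where
  "hyperbolic_closed_asymptotic_line \<xi> \<gamma> l \<longleftrightarrow>
     closed_asymptotic_line \<xi> \<gamma> l \<and>
     (\<forall>x. \<not> parabolic_point \<xi> (\<gamma> x)) \<and>
     tubular_admissible \<gamma> \<and>
     (\<exists>P. is_poincare_map \<xi> \<gamma> l P \<and> P differentiable (at 0) \<and>
        (\<forall>\<mu>. complex_eigenvalue (matrix (frechet_derivative P (at 0))) \<mu> \<longrightarrow>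
              \<mu> \<notin> sphere 0 1))"

end

theory Submission
  imports Defs
begin

text \<open>
  The direction field is chosen first and the plane field is read off from it. If the acceleration
  of the orbits of a vector field \<open>D\<close> is \<open>A = dD(D)\<close>, then the osculating planes of the orbits have
  normal \<open>D \<times> A\<close>, and \<open>D\<close> is an asymptotic direction of the plane field \<open>\<xi> = D \<times> A\<close>:
  differentiating \<open>\<langle>\<xi>, D\<rangle> = 0\<close> along \<open>D\<close> gives \<open>\<langle>d\<xi>(D), D\<rangle> = - \<langle>\<xi>, A\<rangle> = 0\<close>. So it suffices to find a
  polynomial field \<open>D\<close> that has \<open>\<gamma>\<close> as a hyperbolic closed orbit and whose flow is elementary.

  Let \<open>\<sigma> = X\<^sup>2 + Y\<^sup>2\<close> and \<open>w = Z - X\<^sup>3 - 11 (\<sigma> - 1)\<close>; the curve is \<open>\<sigma> = 1\<close>, \<open>w = 0\<close>. The field \<open>drift\<close> turns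
  with unit angular speed about the vertical axis and satisfies \<open>\<sigma>' = \<sigma> (1 - \<sigma>)\<close> and \<open>w' = w\<close>. Hence its
  flow is explicit, and after one turn the distance to \<open>\<sigma> = 1\<close> is multiplied to first order by
  \<open>exp (- 2 \<pi>)\<close> and \<open>w\<close> by \<open>exp (2 \<pi>)\<close>: the curve is a saddle. Two further points have to be checked.

  First, \<open>\<gamma>\<close> carries no parabolic point. With \<open>\<langle>\<xi>, D\<rangle> = \<langle>\<xi>, A\<rangle> = 0\<close> the polarized second fundamental form
  at \<open>(D, A)\<close> is \<open>- \<langle>\<xi>, \<gamma>''' + dD(\<gamma>'')\<rangle>\<close>, a trigonometric polynomial in which the coefficient
  \<open>11\<close> of \<open>w\<close> produces the constant term \<open>44\<close>; the other terms are at most \<open>42\<close>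
  (\<open>curve_not_parabolic\<close>). Since one root \<open>D\<close> of the quadratic form is already known, this is enough
  for two distinct real roots (\<open>not_parabolic_pointI\<close>).

  Second, \<open>D \<times> A\<close> vanishes at some points of space, necessarily so on the axis, around which the planar
  projection of \<open>D\<close> turns. Its third component is a polynomial in \<open>\<sigma>\<close> that is nonzero near \<open>\<sigma> = 1\<close>, so
  adding to it a multiple of a fourth power of a positive part, which is of class \<open>C\<^sup>3\<close> and
  vanishes near \<open>\<gamma>\<close>, gives a nonvanishing field on the whole space (\<open>osculating_nonzero\<close>).

  The Poincare map is parametrized by the position \<open>x\<close> of the normal plane of \<open>\<gamma>\<close> that contains the point,
  not by the time of the flow. An implicit function argument (\<open>section_reparametrization\<close>) turns every
  orbit near \<open>\<gamma>\<close> into a curve \<open>x \<mapsto> (x, y(x), z(x))\<close>. At \<open>x = 0\<close> and \<open>x = 2 \<pi>\<close> the normal plane is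
  \<open>X = 0\<close>, which the orbit meets at these very times, so the return map is explicit. Its derivative is
  triangular with eigenvalues \<open>exp (- 2 \<pi>)\<close> and \<open>exp (2 \<pi>)\<close>.
\<close>

section \<open>Vectors given by their components\<close>

lemma vector_3_eq_sum_axis:
  "(vector [a, b, c] :: real^3) = a *\<^sub>R axis 1 1 + b *\<^sub>R axis 2 1 + c *\<^sub>R axis 3 1"
  by (simp add: vec_eq_iff forall_3 axis_def)

lemma vector_2_eq_sum_axis:
  "(vector [a, b] :: real^2) = a *\<^sub>R axis 1 1 + b *\<^sub>R axis 2 1"
  by (simp add: vec_eq_iff forall_2 axis_def)

lemma has_derivative_vector_3:
  assumes "(f has_derivative f') F" "(g has_derivative g') F" "(h has_derivative h') F"
  shows "((\<lambda>x. vector [f x, g x, h x] :: real^3) has_derivative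
          (\<lambda>v. vector [f' v, g' v, h' v])) F"
  unfolding vector_3_eq_sum_axis by (intro derivative_intros assms)

lemma has_derivative_vector_2:
  assumes "(f has_derivative f') F" "(g has_derivative g') F"
  shows "((\<lambda>x. vector [f x, g x] :: real^2) has_derivative (\<lambda>v. vector [f' v, g' v])) F"
  unfolding vector_2_eq_sum_axis by (intro derivative_intros assms)

lemma has_vector_derivative_vector_3:
  assumes "(f has_real_derivative f') F" "(g has_real_derivative g') F"
    "(h has_real_derivative h') F"
  shows "((\<lambda>x. vector [f x, g x, h x] :: real^3) has_vector_derivative
          (vector [f', g', h'])) F"
  using has_derivative_vector_3[OF assms[unfolded has_field_derivative_def]]
  unfolding has_vector_derivative_def
  by (rule has_derivative_eq_rhs) (auto simp: vec_eq_iff forall_3 fun_eq_iff mult.commute)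

lemmas has_derivative_vec_nth [derivative_intros] =
  bounded_linear.has_derivative[OF bounded_linear_vec_nth]

lemma continuous_on_vector_3 [continuous_intros]:
  assumes "continuous_on S f" "continuous_on S g" "continuous_on S h"
  shows "continuous_on S (\<lambda>x. vector [f x, g x, h x] :: real^3)"
  unfolding vector_3_eq_sum_axis by (intro continuous_intros assms)

lemma inner_real_3: "(u::real^3) \<bullet> v = u $ 1 * v $ 1 + u $ 2 * v $ 2 + u $ 3 * v $ 3"
  by (simp add: inner_vec_def sum_3)

lemma norm_real_3: "norm (u::real^3) = sqrt ((u $ 1)\<^sup>2 + (u $ 2)\<^sup>2 + (u $ 3)\<^sup>2)"
  by (simp add: norm_eq_sqrt_inner inner_real_3 power2_eq_square)

section \<open>The curve\<close>

text \<open>The derivatives of the curve, in closed form: by \<open>sin\<^sup>3 x = (3 sin x - sin 3x) / 4\<close> every component is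
  a combination of sines, and differentiation shifts a phase by \<open>\<pi> / 2\<close>.\<close>

definition curve_jet :: "nat \<Rightarrow> real \<Rightarrow> real^3" where
  "curve_jet k x = vector [sin (x + k * (pi / 2)), cos (x + k * (pi / 2)),
     (3 * sin (x + k * (pi / 2)) - 3 ^ k * sin (3 * x + k * (pi / 2))) / 4]"

lemma sin_cubed: "sin (x::real) ^ 3 = (3 * sin x - sin (3 * x)) / 4"
proof -
  have "sin (3 * x) = sin (2 * x + x)" by (simp add: algebra_simps)
  also have "\<dots> = 2 * sin x * cos x * cos x + (1 - 2 * (sin x)\<^sup>2) * sin x"
    unfolding sin_add sin_double cos_double_sin by simp
  also have "\<dots> = 2 * sin x * (cos x)\<^sup>2 + (1 - 2 * (sin x)\<^sup>2) * sin x"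
    by (simp add: power2_eq_square)
  also have "\<dots> = 3 * sin x - 4 * sin x ^ 3"
    using sin_cos_squared_add[of x] by algebra
  finally show ?thesis by simp
qed

lemma curve_jet_has_vector_derivative:
  "(curve_jet k has_vector_derivative curve_jet (Suc k) x) (at x)"
proof -
  have shift: "x + real (Suc k) * (pi / 2) = (x + real k * (pi / 2)) + pi / 2" for x
    by (simp add: algebra_simps)
  have s: "sin (u + pi / 2) = cos u" and c: "cos (u + pi / 2) = - sin u" for u :: real
    by (simp_all add: sin_add cos_add)
  show ?thesis
    unfolding curve_jet_def shift s c
    by (rule has_vector_derivative_vector_3)
       (auto intro!: derivative_eq_intros simp: field_simps)
qed

lemma curve_deriv_eq_curve_jet: "curve_deriv k (curve_jet 0) = curve_jet k"
proof (induction k)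
  case 0
  then show ?case by (simp add: curve_deriv_def)
next
  case (Suc k)
  have "curve_deriv (Suc k) (curve_jet 0)
      = (\<lambda>x. vector_derivative (curve_deriv k (curve_jet 0)) (at x))"
    by (simp add: curve_deriv_def)
  also have "\<dots> = curve_jet (Suc k)"
    unfolding Suc using vector_derivative_at[OF curve_jet_has_vector_derivative] by blast
  finally show ?case .
qed

lemma curve_jet_0: "curve_jet 0 x = vector [sin x, cos x, sin x ^ 3]"
  by (simp add: curve_jet_def sin_cubed)

lemma curve_jet_Suc_eqI:
  assumes "\<And>x. curve_jet k x = vector [f x, g x, h x]"
    "(f has_real_derivative f') (at x)" "(g has_real_derivative g') (at x)"
    "(h has_real_derivative h') (at x)"
  shows "curve_jet (Suc k) x = vector [f', g', h']"
proof -
  have "curve_jet k = (\<lambda>x. vector [f x, g x, h x])" using assms(1) by blast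
  then have "(curve_jet k has_vector_derivative vector [f', g', h']) (at x)"
    using has_vector_derivative_vector_3[OF assms(2-4)] by simp
  then show ?thesis
    using curve_jet_has_vector_derivative vector_derivative_unique_at by blast
qed

lemma curve_jet_1: "curve_jet 1 x = vector [cos x, - sin x, 3 * (sin x)\<^sup>2 * cos x]"
  unfolding One_nat_def
  by (rule curve_jet_Suc_eqI[OF curve_jet_0]) (auto intro!: derivative_eq_intros)

lemma curve_jet_2:
  "curve_jet 2 x = vector [- sin x, - cos x, 6 * sin x * (cos x)\<^sup>2 - 3 * sin x ^ 3]"
  unfolding numeral_2_eq_2
  by (rule curve_jet_Suc_eqI[OF curve_jet_1[unfolded One_nat_def]])
     (auto intro!: derivative_eq_intros simp: power2_eq_square power3_eq_cube)

lemma curve_jet_3: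
  "curve_jet 3 x = vector [- cos x, sin x, 6 * cos x ^ 3 - 21 * (sin x)\<^sup>2 * cos x]"
  unfolding numeral_3_eq_3
  by (rule curve_jet_Suc_eqI[OF curve_jet_2[unfolded numeral_2_eq_2]])
     (auto intro!: derivative_eq_intros simp: power2_eq_square power3_eq_cube)

text \<open>Two differentiations reverse the horizontal components, so the sum is vertical. Its size is a phase
  of \<open>3 x\<close>; for \<open>k = 1\<close> and \<open>k = 2\<close> it is a cosine and a sine, which do not vanish together.
  This is why the first four derivatives always span.\<close>

lemma curve_jet_add_shift:
  "curve_jet k x + curve_jet (k + 2) x = (2 * 3 ^ k * sin (3 * x + k * (pi / 2))) *\<^sub>R axis 3 1"
proof -
  have shift: "x + real (k + 2) * (pi / 2) = (x + real k * (pi / 2)) + pi" for x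
    by (simp add: algebra_simps)
  show ?thesis
    unfolding curve_jet_def shift sin_periodic_pi cos_periodic_pi
    by (simp add: vec_eq_iff forall_3 axis_def field_simps)
qed

lemma finite_type_curve_jet: "finite_type_curve (curve_jet 0)"
proof -
  have "curve_jet 1 x \<noteq> 0" for x
  proof
    assume "curve_jet 1 x = 0"
    then have "cos x = 0" "sin x = 0"
      unfolding curve_jet_1 by (simp_all add: vec_eq_iff forall_3)
    with sin_cos_squared_add[of x] show False by simp
  qed
  moreover have "curve_jet k differentiable (at x)" for k x
    using curve_jet_has_vector_derivative differentiableI_vector by blast
  ultimately have "smooth_immersed_curve (curve_jet 0)"
    unfolding smooth_immersed_curve_def curve_deriv_eq_curve_jet by blast
  moreover have "span ((\<lambda>j. curve_jet j x) ` {1..4}) = UNIV" (is "?S = _") for x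
  proof -
    have jet: "curve_jet j x \<in> ?S" if "j \<in> {1..4}" for j
      using that by (intro span_base) auto
    \<comment> \<open>One of these two vertical vectors is nonzero.\<close>
    have 3: "curve_jet 1 x + curve_jet 3 x = (6 * cos (3 * x)) *\<^sub>R axis 3 1"
      using curve_jet_add_shift[of 1 x] by (simp add: sin_add numeral_3_eq_3)
    have 4: "curve_jet 2 x + curve_jet 4 x = (- 18 * sin (3 * x)) *\<^sub>R axis 3 1"
      using curve_jet_add_shift[of 2 x] by (simp add: sin_add)
    have "axis 3 1 \<in> ?S"
    proof (cases "cos (3 * x) = 0")
      case True
      then have "sin (3 * x) \<noteq> 0" using sin_cos_squared_add[of "3 * x"] by auto
      then have *: "axis 3 1 = (1 / (- 18 * sin (3 * x))) *\<^sub>R (curve_jet 2 x + curve_jet 4 x)"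
        unfolding 4 by simp
      show ?thesis unfolding * by (intro span_scale span_add jet) auto
    next
      case False
      then have *: "axis 3 1 = (1 / (6 * cos (3 * x))) *\<^sub>R (curve_jet 1 x + curve_jet 3 x)"
        unfolding 3 by simp
      show ?thesis unfolding * by (intro span_scale span_add jet) auto
    qed
    have "v \<in> ?S" for v
    proof -
      have trig: "cos x * (cos x * a) + sin x * (sin x * a) = a" for a
        using sin_cos_squared_add[of x] by algebra
      let ?p = "cos x * v $ 1 - sin x * v $ 2" and ?q = "- sin x * v $ 1 - cos x * v $ 2"
      let ?r = "?p * curve_jet 1 x $ 3 + ?q * curve_jet 2 x $ 3"
      have *: "v = ?p *\<^sub>R curve_jet 1 x + ?q *\<^sub>R curve_jet 2 x + (v $ 3 - ?r) *\<^sub>R axis 3 1"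
        unfolding vec_eq_iff forall_3 curve_jet_1 curve_jet_2
        by (auto simp: axis_def algebra_simps trig)
      show ?thesis
        by (subst *) (intro span_add span_scale jet \<open>axis 3 1 \<in> ?S\<close>; simp)
    qed
    then show ?thesis by blast
  qed
  ultimately show ?thesis
    unfolding finite_type_curve_def finite_type_at_def curve_deriv_eq_curve_jet by blast
qed

section \<open>Functions of class C^k\<close>

text \<open>The scalar analogue of \<open>class_C\<close>: polynomial expressions in the components are handled by closure
  under sums and products.\<close>

fun scalar_C :: "nat \<Rightarrow> (real^3 \<Rightarrow> real) \<Rightarrow> bool" where
  "scalar_C 0 g \<longleftrightarrow> continuous_on UNIV g"
| "scalar_C (Suc k) g \<longleftrightarrow> g differentiable_on UNIV \<and>
     (\<forall>i. scalar_C k (\<lambda>r. frechet_derivative g (at r) (axis i 1)))"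

lemma scalar_C_SucI:
  assumes "\<And>r. (g has_derivative g' r) (at r)" "\<And>i. scalar_C k (\<lambda>r. g' r (axis i 1))"
  shows "scalar_C (Suc k) g"
proof -
  have "frechet_derivative g (at r) = g' r" for r
    using frechet_derivative_at[OF assms(1)] by simp
  then show ?thesis
    using assms by (auto simp: differentiable_on_def intro: differentiableI)
qed

lemma scalar_C_SucD:
  assumes "scalar_C (Suc k) g"
  shows "(g has_derivative frechet_derivative g (at r)) (at r)"
    and "scalar_C k (\<lambda>r. frechet_derivative g (at r) (axis i 1))"
  using assms by (auto simp: differentiable_on_def frechet_derivative_works)

text \<open>In a product rule the undifferentiated factor is only needed to one order less.\<close>

lemma scalar_C_lower: "scalar_C (Suc k) g \<Longrightarrow> scalar_C k g"
proof (induction k arbitrary: g)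
  case 0
  then show ?case using differentiable_imp_continuous_on by auto
next
  case (Suc k)
  show ?case
    by (rule scalar_C_SucI[OF scalar_C_SucD(1)[OF Suc.prems]])
       (rule Suc.IH[OF scalar_C_SucD(2)[OF Suc.prems]])
qed

lemma scalar_C_const: "scalar_C k (\<lambda>r. c)"
proof (induction k arbitrary: c)
  case 0
  show ?case by simp
next
  case (Suc k)
  show ?case by (rule scalar_C_SucI[OF has_derivative_const]) (rule Suc)
qed

lemma scalar_C_component: "scalar_C k (\<lambda>r. r $ i)"
proof (cases k)
  case 0
  then show ?thesis by (auto intro: continuous_intros)
next
  case (Suc j)
  show ?thesis unfolding Suc
    by (rule scalar_C_SucI[OF has_derivative_vec_nth[OF has_derivative_ident]])
       (rule scalar_C_const)
qed

lemma scalar_C_add: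
  assumes "scalar_C k f" "scalar_C k g"
  shows "scalar_C k (\<lambda>r. f r + g r)"
  using assms
proof (induction k arbitrary: f g)
  case 0
  then show ?case by (auto intro: continuous_intros)
next
  case (Suc k)
  show ?case
    by (rule scalar_C_SucI[OF has_derivative_add[OF Suc.prems[THEN scalar_C_SucD(1)]]])
       (intro Suc.IH Suc.prems[THEN scalar_C_SucD(2)])
qed

lemma scalar_C_mult:
  assumes "scalar_C k f" "scalar_C k g"
  shows "scalar_C k (\<lambda>r. f r * g r)"
  using assms
proof (induction k arbitrary: f g)
  case 0
  then show ?case by (auto intro: continuous_intros)
next
  case (Suc k)
  show ?case
    by (rule scalar_C_SucI[OF has_derivative_mult[OF Suc.prems[THEN scalar_C_SucD(1)]]])
       (intro scalar_C_add Suc.IH Suc.prems[THEN scalar_C_SucD(2)]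
         Suc.prems[THEN scalar_C_lower])
qed

lemma scalar_C_diff:
  assumes "scalar_C k f" "scalar_C k g"
  shows "scalar_C k (\<lambda>r. f r - g r)"
  using scalar_C_add[OF assms(1) scalar_C_mult[OF scalar_C_const[of k "- 1"] assms(2)]] by simp

lemma scalar_C_power: "scalar_C k f \<Longrightarrow> scalar_C k (\<lambda>r. f r ^ n)"
  by (induction n) (auto intro: scalar_C_const scalar_C_mult)

lemma has_real_derivative_pos_part_power:
  "((\<lambda>t. max 0 t ^ (n + 2)) has_real_derivative real (n + 2) * max 0 t ^ (n + 1)) (at t)"
proof (cases "t = 0")
  case True
  have "((\<lambda>h. max 0 h ^ (n + 1)) \<longlongrightarrow> max 0 0 ^ (n + 1)) (at (0::real))"
    by (intro tendsto_intros)
  then have "((\<lambda>h. max 0 h ^ (n + 1)) \<longlongrightarrow> 0) (at (0::real))" by simp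
  moreover have "max 0 (0 + h) ^ (n + 2) / h = max 0 h ^ (n + 1)" if "h \<noteq> 0" for h :: real
    using that by (auto simp: max_def)
  ultimately show ?thesis
    unfolding True DERIV_def
    by (auto cong: Lim_cong_within)
next
  case False
  show ?thesis
  proof (cases "0 < t")
    case True
    have "((\<lambda>t. t ^ (n + 2)) has_real_derivative real (n + 2) * t ^ (n + 1)) (at t)"
      using DERIV_pow[of "n + 2" t UNIV] by simp
    moreover have "\<forall>\<^sub>F s in nhds t. max 0 s ^ (n + 2) = s ^ (n + 2)"
      using eventually_nhds_in_open[of "{0<..}" t] True by (auto elim!: eventually_mono)
    ultimately show ?thesis using True by (simp add: DERIV_cong_ev)
  next
    case neg: False
    have "\<forall>\<^sub>F s in nhds t. max 0 s ^ (n + 2) = (0::real)"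
      using eventually_nhds_in_open[of "{..<0}" t] False neg by (auto elim!: eventually_mono)
    then have "((\<lambda>t. max 0 t ^ (n + 2)) has_real_derivative 0) (at t)"
      by (simp only: DERIV_cong_ev[OF refl _ refl] DERIV_const)
    then show ?thesis using neg False by (simp add: max_def)
  qed
qed

text \<open>The exponent \<open>k + 1\<close> matches the induction: the derivative of \<open>t\<^sub>+ ^ (k + 2)\<close> is a multiple of
  \<open>t\<^sub>+ ^ (k + 1)\<close>.\<close>

lemma scalar_C_pos_part_power: "scalar_C k g \<Longrightarrow> scalar_C k (\<lambda>r. max 0 (g r) ^ (k + 1))"
proof (induction k arbitrary: g)
  case 0
  then show ?case by (auto intro!: continuous_intros)
next
  case (Suc k)
  let ?g' = "\<lambda>r. frechet_derivative g (at r)"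
  have "((\<lambda>r. max 0 (g r) ^ (k + 2)) has_derivative
          (\<lambda>v. (real (k + 2) * max 0 (g r) ^ (k + 1)) * ?g' r v)) (at r)" for r
    using has_derivative_compose[OF scalar_C_SucD(1)[OF Suc.prems]
        has_real_derivative_pos_part_power[unfolded has_field_derivative_def]] by simp
  moreover have "scalar_C k (\<lambda>r. (real (k + 2) * max 0 (g r) ^ (k + 1)) * ?g' r (axis i 1))" for i
    by (intro scalar_C_mult scalar_C_const Suc.IH scalar_C_lower[OF Suc.prems]
        scalar_C_SucD(2)[OF Suc.prems])
  ultimately have "scalar_C (Suc k) (\<lambda>r. max 0 (g r) ^ (k + 2))" by (rule scalar_C_SucI)
  then show ?case by simp
qed

lemma class_C_vector_3:
  assumes "scalar_C k f" "scalar_C k g" "scalar_C k h"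
  shows "class_C k (\<lambda>r. vector [f r, g r, h r])"
  using assms
proof (induction k arbitrary: f g h)
  case 0
  then show ?case by (auto intro: continuous_intros)
next
  case (Suc k)
  let ?F = "\<lambda>r. vector [f r, g r, h r] :: real^3"
  have D: "(?F has_derivative (\<lambda>v. vector [frechet_derivative f (at r) v,
      frechet_derivative g (at r) v, frechet_derivative h (at r) v])) (at r)" for r
    by (intro has_derivative_vector_3 Suc.prems[THEN scalar_C_SucD(1)])
  have "class_C k (\<lambda>r. frechet_derivative ?F (at r) (axis i 1))" for i
    unfolding frechet_derivative_at[OF D, symmetric]
    by (intro Suc.IH Suc.prems[THEN scalar_C_SucD(2)])
  moreover have "?F differentiable_on UNIV"
    using D by (auto simp: differentiable_on_def intro: differentiableI)
  ultimately show ?case by simp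
qed

section \<open>A criterion for points not to be parabolic\<close>

text \<open>On the plane the quadratic form \<open>a u + b v \<mapsto> \<langle>d\<xi>(a u + b v), a u + b v\<rangle>\<close> equals \<open>b (a B + b C)\<close>, where \<open>B\<close>
  is the mixed coefficient. As \<open>B \<noteq> 0\<close> it has two distinct roots: \<open>u\<close> and \<open>- C u + B v\<close>.\<close>

lemma not_parabolic_pointI:
  assumes lin: "linear (frechet_derivative \<xi> (at r))"
    and u: "asymptotic_direction \<xi> r u" and v: "\<xi> r \<bullet> v = 0"
    and B: "frechet_derivative \<xi> (at r) u \<bullet> v + frechet_derivative \<xi> (at r) v \<bullet> u \<noteq> 0"
  shows "\<not> parabolic_point \<xi> r"
proof -
  let ?L = "frechet_derivative \<xi> (at r)"
  let ?B = "?L u \<bullet> v + ?L v \<bullet> u"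
  have u': "u \<noteq> 0" "\<xi> r \<bullet> u = 0" "?L u \<bullet> u = 0"
    using u by (auto simp: asymptotic_direction_def)
  have indep: "a = 0" if "a *\<^sub>R v = b *\<^sub>R u" for a b
  proof (rule ccontr)
    assume "a \<noteq> 0"
    then have "v = (b / a) *\<^sub>R u"
      using that by (metis divide_inverse_commute scaleR_scaleR vector_fraction_eq_iff)
    then have "?B = 2 * (b / a) * (?L u \<bullet> u)" by (simp add: linear_scale[OF lin])
    with B u' show False by simp
  qed
  have quad: "?L (a *\<^sub>R u + b *\<^sub>R v) \<bullet> (a *\<^sub>R u + b *\<^sub>R v) = b * (a * ?B + b * (?L v \<bullet> v))" for a b
    using u' by (simp add: linear_add[OF lin] linear_scale[OF lin] inner_add_left inner_add_right
        algebra_simps)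
  have plane: "\<xi> r \<bullet> (a *\<^sub>R u + b *\<^sub>R v) = 0" for a b
    using u' v by (simp add: inner_add_right)
  define v2 where "v2 = (- (?L v \<bullet> v)) *\<^sub>R u + ?B *\<^sub>R v"
  have "v2 \<noteq> 0"
    using indep[of ?B "?L v \<bullet> v"] B unfolding v2_def by (auto simp: algebra_simps)
  then have v2: "asymptotic_direction \<xi> r v2"
    unfolding asymptotic_direction_def v2_def plane quad by simp
  have "\<not> (\<forall>v. asymptotic_direction \<xi> r v \<longrightarrow> (\<exists>c. v = c *\<^sub>R w))" for w
  proof
    assume *: "\<forall>v. asymptotic_direction \<xi> r v \<longrightarrow> (\<exists>c. v = c *\<^sub>R w)"
    obtain c where c: "u = c *\<^sub>R w" using * u by blast
    obtain d where d: "v2 = d *\<^sub>R w" using * v2 by blast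
    have "c \<noteq> 0" using c u' by auto
    then have "v2 = (d / c) *\<^sub>R u" using c d by simp
    then have "?B *\<^sub>R v = (d / c + ?L v \<bullet> v) *\<^sub>R u"
      unfolding v2_def by (simp add: algebra_simps)
    with indep B show False by blast
  qed
  moreover have "\<not> (\<forall>v. v \<noteq> 0 \<and> \<xi> r \<bullet> v = 0 \<longrightarrow> asymptotic_direction \<xi> r v)"
  proof
    assume *: "\<forall>v. v \<noteq> 0 \<and> \<xi> r \<bullet> v = 0 \<longrightarrow> asymptotic_direction \<xi> r v"
    have zero: "b * (a * ?B + b * (?L v \<bullet> v)) = 0" for a b
    proof (cases "a *\<^sub>R u + b *\<^sub>R v = 0")
      case True
      then show ?thesis using quad[of a b] by (metis inner_zero_right)
    next
      case False
      then show ?thesis using * plane quad unfolding asymptotic_direction_def by metis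
    qed
    show False using zero[of 1 1] zero[of 1 0] zero[of 0 1] B by simp
  qed
  ultimately show ?thesis unfolding parabolic_point_def by blast
qed

section \<open>Normal sections\<close>

text \<open>Caratheodory's form of differentiability for vector valued curves.\<close>

lemma has_vector_derivative_slope:
  fixes f :: "real \<Rightarrow> 'a::real_normed_vector"
  assumes "(f has_vector_derivative D) (at t)"
  obtains Q where "\<And>s. f s - f t = (s - t) *\<^sub>R Q s" "isCont Q t" "Q t = D"
proof
  let ?Q = "\<lambda>s. if s = t then D else (1 / (s - t)) *\<^sub>R (f s - f t)"
  show "f s - f t = (s - t) *\<^sub>R ?Q s" for s by simp
  have "norm ((1 / (s - t)) *\<^sub>R (f s - f t) - D) = norm (f s - f t - (s - t) *\<^sub>R D) / norm (s - t)"
    if "s \<noteq> t" for s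
  proof -
    have "(1 / (s - t)) *\<^sub>R (f s - f t) - D = (1 / (s - t)) *\<^sub>R (f s - f t - (s - t) *\<^sub>R D)"
      using that by (simp add: scaleR_diff_right)
    then show ?thesis by simp
  qed
  moreover have "((\<lambda>s. norm (f s - f t - (s - t) *\<^sub>R D) / norm (s - t)) \<longlongrightarrow> 0) (at t)"
    using assms by (simp add: has_vector_derivative_def has_derivative_iff_norm)
  ultimately have "((\<lambda>s. norm ((1 / (s - t)) *\<^sub>R (f s - f t) - D)) \<longlongrightarrow> 0) (at t)"
    by (auto cong: Lim_cong_within)
  then have "((\<lambda>s. (1 / (s - t)) *\<^sub>R (f s - f t)) \<longlongrightarrow> D) (at t)"
    by (simp only: tendsto_norm_zero_iff LIM_zero_iff)
  then show "isCont ?Q t"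
    unfolding isCont_def by (auto cong: Lim_cong_within)
  show "?Q t = D" by simp
qed

text \<open>A curve \<open>\<Phi>\<close> that is \<open>C\<^sup>1\<close>-close to \<open>\<gamma>\<close> meets each normal plane of \<open>\<gamma>\<close> once nearby. The plane at \<open>x\<close> is the
  zero set of \<open>g t x = \<langle>\<Phi> t - \<gamma> x, \<gamma>' x\<rangle>\<close>, and \<open>\<partial>g/\<partial>t = \<langle>\<Phi>' t, \<gamma>' x\<rangle>\<close> is close to \<open>|\<gamma>' x|\<^sup>2 \<ge> 1\<close> as long as \<open>t\<close> is
  close to \<open>x\<close>. The bounds are chosen such that \<open>\<partial>g/\<partial>t \<ge> 1/2\<close> for \<open>|t - x| \<le> 2 \<delta>\<close>, while \<open>|g x x|\<close> is at most
  \<open>\<delta> / 4\<close>, so that \<open>t\<close> can be found within distance \<open>\<delta>\<close> of \<open>x\<close>. The last conclusion says that no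
  reparametrization takes place where \<open>\<Phi>\<close> already lies in the right plane.\<close>

lemma section_reparametrization:
  fixes \<gamma> \<gamma>' \<gamma>'' \<Phi> \<Phi>' :: "real \<Rightarrow> 'a::real_inner" and M a b :: real
  defines "\<delta> \<equiv> 1 / (8 * M\<^sup>2)" and "\<epsilon> \<equiv> 1 / (32 * M ^ 3)"
  assumes M: "M \<ge> 1"
    and \<gamma>: "\<And>x. (\<gamma> has_vector_derivative \<gamma>' x) (at x)"
    and \<gamma>': "\<And>x. (\<gamma>' has_vector_derivative \<gamma>'' x) (at x)"
    and bd: "\<And>x. 1 \<le> norm (\<gamma>' x)" "\<And>x. norm (\<gamma>' x) \<le> M" "\<And>x. norm (\<gamma>'' x) \<le> M"
    and \<Phi>: "\<And>t. t \<in> {a - \<delta>..b + \<delta>} \<Longrightarrow> (\<Phi> has_vector_derivative \<Phi>' t) (at t)"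
    and close: "\<And>t. t \<in> {a - \<delta>..b + \<delta>} \<Longrightarrow> norm (\<Phi> t - \<gamma> t) \<le> \<epsilon>"
      "\<And>t. t \<in> {a - \<delta>..b + \<delta>} \<Longrightarrow> norm (\<Phi>' t - \<gamma>' t) \<le> \<epsilon>"
  obtains \<tau> \<sigma> where
    "\<And>x. x \<in> {a..b} \<Longrightarrow> \<tau> x \<in> {a - \<delta>..b + \<delta>} \<and> (\<Phi> (\<tau> x) - \<gamma> x) \<bullet> \<gamma>' x = 0"
    "\<And>x. x \<in> {a..b} \<Longrightarrow> (\<tau> has_real_derivative \<sigma> x) (at x within {a..b}) \<and> \<sigma> x \<noteq> 0"
    "\<And>x. x \<in> {a..b} \<Longrightarrow> (\<Phi> x - \<gamma> x) \<bullet> \<gamma>' x = 0 \<Longrightarrow> \<tau> x = x"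
proof -
  define I where "I = {a - \<delta>..b + \<delta>}"
  define g where "g t x = (\<Phi> t - \<gamma> x) \<bullet> \<gamma>' x" for t x
  have pos: "\<delta> > 0" "\<epsilon> > 0" using M by (auto simp: \<delta>_def \<epsilon>_def)
  have M\<delta>: "M * (M * \<delta>) = 1 / 8" "M * \<epsilon> = \<delta> / 4"
    using M by (auto simp: \<delta>_def \<epsilon>_def field_simps power2_eq_square power3_eq_cube)
  have "1 \<le> M * M" using mult_mono[of 1 M 1 M] M by simp
  then have "\<delta> \<le> 1 / 8"
    using M by (simp add: \<delta>_def field_simps power2_eq_square)
  have CS: "\<bar>u \<bullet> v\<bar> \<le> e * M" if "norm u \<le> e" "norm v \<le> M" for u v :: 'a and e
    using that Cauchy_Schwarz_ineq2[of u v] mult_mono[of "norm u" e "norm v" M]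
    by (smt (verit) norm_ge_zero)
  have lip_aux: "norm (f t - f x) \<le> M * \<bar>t - x\<bar>"
    if "\<And>x. (f has_vector_derivative f' x) (at x)" "\<And>x. norm (f' x) \<le> M"
    for f f' :: "real \<Rightarrow> 'a" and t x
  proof -
    have "onorm (\<lambda>h::real. h *\<^sub>R f' x) \<le> M" for x
      using that(2)[of x] onorm_scaleR_left[of "\<lambda>h::real. h" "f' x"]
      by (simp add: bounded_linear_ident onorm_id)
    then have "norm (f t - f x) \<le> M * norm (t - x)"
      using that(1) unfolding has_vector_derivative_def
      by (intro differentiable_bound[of UNIV]) auto
    then show ?thesis by simp
  qed
  note lip = lip_aux[OF \<gamma> bd(2)] lip_aux[OF \<gamma>' bd(3)]
  have slope: "\<Phi>' t \<bullet> \<gamma>' x \<ge> 1 / 2" if "t \<in> I" "\<bar>t - x\<bar> \<le> 2 * \<delta>" for t x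
  proof -
    have "\<Phi>' t \<bullet> \<gamma>' x = \<gamma>' x \<bullet> \<gamma>' x + (\<Phi>' t - \<gamma>' t) \<bullet> \<gamma>' x + (\<gamma>' t - \<gamma>' x) \<bullet> \<gamma>' x"
      by (simp add: inner_diff_left)
    moreover have "\<gamma>' x \<bullet> \<gamma>' x \<ge> 1"
      using bd(1)[of x] by (simp add: dot_square_norm)
    moreover have "\<bar>(\<Phi>' t - \<gamma>' t) \<bullet> \<gamma>' x\<bar> \<le> \<epsilon> * M"
      using CS close(2) bd(2) that(1) by (auto simp: I_def)
    moreover have "\<bar>(\<gamma>' t - \<gamma>' x) \<bullet> \<gamma>' x\<bar> \<le> (M * (2 * \<delta>)) * M"
    proof (rule CS[OF _ bd(2)])
      show "norm (\<gamma>' t - \<gamma>' x) \<le> M * (2 * \<delta>)"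
        using lip(2)[of t x] mult_left_mono[OF that(2), of M] M by linarith
    qed
    ultimately show ?thesis using M\<delta> \<open>\<delta> \<le> 1 / 8\<close> by (simp add: mult_ac)
  qed
  have g_deriv: "((\<lambda>t. g t x) has_real_derivative \<Phi>' t \<bullet> \<gamma>' x) (at t)" if "t \<in> I" for t x
    unfolding g_def has_real_derivative_iff_has_vector_derivative
    using \<Phi>[of t] that
    by (auto simp: I_def has_vector_derivative_def intro!: derivative_eq_intros)
  have g_mono: "g t x - g s x \<ge> (t - s) / 2"
    if "s \<in> I" "t \<in> I" "s \<le> t" "\<bar>s - x\<bar> \<le> 2 * \<delta>" "\<bar>t - x\<bar> \<le> 2 * \<delta>" for s t x
  proof (cases "s = t")
    case False
    then have "s < t" using that by simp
    have "\<exists>\<xi>>s. \<xi> < t \<and> g t x - g s x = (t - s) * (\<Phi>' \<xi> \<bullet> \<gamma>' x)"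
      using \<open>s < t\<close> that by (intro MVT2 g_deriv) (auto simp: I_def)
    then obtain \<xi> where \<xi>: "s < \<xi>" "\<xi> < t" "g t x - g s x = (t - s) * (\<Phi>' \<xi> \<bullet> \<gamma>' x)" by blast
    have "\<Phi>' \<xi> \<bullet> \<gamma>' x \<ge> 1 / 2" using \<xi> that by (intro slope) (auto simp: I_def)
    then have "(t - s) * (1 / 2) \<le> (t - s) * (\<Phi>' \<xi> \<bullet> \<gamma>' x)"
      using \<open>s < t\<close> by (intro mult_left_mono) auto
    then show ?thesis using \<xi>(3) by simp
  qed simp
  \<comment> \<open>The window is twice as wide as the one for the solution, so that the solutions at two
    neighbouring values of x can be compared in one and the same normal plane.\<close>
  have g_expand: "\<bar>t - s\<bar> \<le> 2 * \<bar>g t x - g s x\<bar>"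
    if "s \<in> I" "t \<in> I" "\<bar>s - x\<bar> \<le> 2 * \<delta>" "\<bar>t - x\<bar> \<le> 2 * \<delta>" for s t x
    using g_mono[of s t x] g_mono[of t s x] that by (cases "s \<le> t") auto
  have "\<exists>t. t \<in> I \<and> \<bar>t - x\<bar> \<le> \<delta> \<and> g t x = 0" if "x \<in> {a..b}" for x
  proof -
    have xI: "x - \<delta> \<in> I" "x \<in> I" "x + \<delta> \<in> I" using that pos by (auto simp: I_def)
    have "\<bar>g x x\<bar> \<le> \<epsilon> * M"
      unfolding g_def using close(1)[of x] xI(2) by (intro CS bd(2)) (auto simp: I_def)
    then have gx: "\<bar>g x x\<bar> \<le> \<delta> / 4" using M\<delta> by (simp add: mult_ac)
    have "g (x - \<delta>) x \<le> 0" using g_mono[OF xI(1) xI(2), of x] gx pos by simp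
    moreover have "0 \<le> g (x + \<delta>) x" using g_mono[OF xI(2) xI(3), of x] gx pos by simp
    moreover have "continuous_on {x - \<delta>..x + \<delta>} (\<lambda>t. g t x)"
      using that by (intro DERIV_continuous_on[OF DERIV_subset[OF g_deriv]]) (auto simp: I_def)
    ultimately obtain t where "x - \<delta> \<le> t" "t \<le> x + \<delta>" "g t x = 0"
      using IVT'[of "\<lambda>t. g t x" "x - \<delta>" 0 "x + \<delta>"] pos by auto
    then show ?thesis using that by (intro exI[of _ t]) (auto simp: I_def)
  qed
  then obtain \<tau> where \<tau>: "\<And>x. x \<in> {a..b} \<Longrightarrow> \<tau> x \<in> I" "\<And>x. x \<in> {a..b} \<Longrightarrow> \<bar>\<tau> x - x\<bar> \<le> \<delta>"
    "\<And>x. x \<in> {a..b} \<Longrightarrow> g (\<tau> x) x = 0" by metis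
  define \<sigma> where "\<sigma> x = - ((\<Phi> (\<tau> x) - \<gamma> x) \<bullet> \<gamma>'' x - \<gamma>' x \<bullet> \<gamma>' x) / (\<Phi>' (\<tau> x) \<bullet> \<gamma>' x)" for x
  have \<tau>_deriv: "(\<tau> has_real_derivative \<sigma> x) (at x within {a..b}) \<and> \<sigma> x \<noteq> 0"
    if x: "x \<in> {a..b}" for x
  proof
    let ?t = "\<tau> x" and ?F = "at x within {a..b}"
    let ?c = "(\<Phi> ?t - \<gamma> x) \<bullet> \<gamma>'' x - \<gamma>' x \<bullet> \<gamma>' x"
    have gx: "((\<lambda>u. g ?t u) has_real_derivative ?c) (at x)"
      unfolding g_def has_real_derivative_iff_has_vector_derivative
      using \<gamma>[of x] \<gamma>'[of x]
      by (auto simp: has_vector_derivative_def algebra_simps intro!: derivative_eq_intros)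
    obtain Q where Q: "\<And>s. \<Phi> s - \<Phi> ?t = (s - ?t) *\<^sub>R Q s" "isCont Q ?t" "Q ?t = \<Phi>' ?t"
      using has_vector_derivative_slope[OF \<Phi>] \<tau>(1)[OF x] unfolding I_def by metis
    have near: "\<forall>\<^sub>F u in ?F. u \<in> {a..b} \<and> \<bar>u - x\<bar> < \<delta>"
      using pos unfolding eventually_at by (auto simp: dist_real_def)
    \<comment> \<open>The difference of the equations g (\<tau> u) u = 0 and g (\<tau> x) x = 0, with the step in the first
      argument expressed by the slope of \<Phi>.\<close>
    have key: "(\<tau> u - ?t) * (Q (\<tau> u) \<bullet> \<gamma>' u) = - (g ?t u - g ?t x)" if "u \<in> {a..b}" for u
    proof -
      have "g (\<tau> u) u - g ?t u = (\<tau> u - ?t) * (Q (\<tau> u) \<bullet> \<gamma>' u)"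
        unfolding g_def inner_diff_left[symmetric] by (simp add: Q(1))
      then show ?thesis using \<tau>(3)[OF that] \<tau>(3)[OF x] by simp
    qed
    have "\<forall>\<^sub>F u in ?F. norm (\<tau> u - ?t) \<le> 2 * \<bar>g ?t u\<bar>"
      using near
    proof eventually_elim
      case (elim u)
      then show ?case
        using g_expand[of ?t "\<tau> u" u] \<tau>(1)[OF x] \<tau>(2)[OF x] \<tau>(3)[of u] \<tau>(1)[of u] \<tau>(2)[of u] pos
        by auto
    qed
    moreover have "((\<lambda>u. 2 * \<bar>g ?t u\<bar>) \<longlongrightarrow> 0) ?F"
    proof -
      have "((\<lambda>u. g ?t u) \<longlongrightarrow> g ?t x) ?F"
        using DERIV_isCont[OF gx] unfolding isCont_def by (rule tendsto_within_subset) simp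
      then show ?thesis
        using \<tau>(3)[OF x] by (intro tendsto_mult_right_zero tendsto_rabs_zero) simp
    qed
    ultimately have "((\<lambda>u. \<tau> u - ?t) \<longlongrightarrow> 0) ?F" by (rule Lim_null_comparison)
    then have \<tau>_cont: "(\<tau> \<longlongrightarrow> ?t) ?F" by (simp add: LIM_zero_iff)
    have "((\<lambda>u. Q (\<tau> u) \<bullet> \<gamma>' u) \<longlongrightarrow> \<Phi>' ?t \<bullet> \<gamma>' x) ?F"
      using isCont_tendsto_compose[OF Q(2) \<tau>_cont] Q(3)
        has_vector_derivative_continuous[OF has_vector_derivative_at_within[OF \<gamma>'[of x]]]
      by (intro tendsto_inner) (auto simp: continuous_within)
    moreover have half: "\<Phi>' ?t \<bullet> \<gamma>' x \<ge> 1 / 2"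
      using slope \<tau>(1,2)[OF x] pos by auto
    moreover have "((\<lambda>u. - ((g ?t u - g ?t x) / (u - x))) \<longlongrightarrow> - ?c) ?F"
      using DERIV_subset[OF gx, of "{a..b}"]
      by (intro tendsto_minus) (auto simp: has_field_derivative_iff)
    ultimately have "((\<lambda>u. - ((g ?t u - g ?t x) / (u - x)) / (Q (\<tau> u) \<bullet> \<gamma>' u)) \<longlongrightarrow> \<sigma> x) ?F"
      unfolding \<sigma>_def by (intro tendsto_divide) auto
    moreover have "\<forall>\<^sub>F u in ?F. Q (\<tau> u) \<bullet> \<gamma>' u \<noteq> 0"
      using \<open>((\<lambda>u. Q (\<tau> u) \<bullet> \<gamma>' u) \<longlongrightarrow> \<Phi>' ?t \<bullet> \<gamma>' x) ?F\<close> half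
      by (intro tendsto_imp_eventually_ne) auto
    then have "\<forall>\<^sub>F u in ?F. - ((g ?t u - g ?t x) / (u - x)) / (Q (\<tau> u) \<bullet> \<gamma>' u)
        = (\<tau> u - ?t) / (u - x)"
      using near
    proof eventually_elim
      case (elim u)
      then have "- (g ?t u - g ?t x) / (Q (\<tau> u) \<bullet> \<gamma>' u) = \<tau> u - ?t"
        using key[of u] by (metis nonzero_mult_div_cancel_right)
      then show ?case by (metis divide_divide_eq_left' divide_divide_eq_left minus_divide_left mult.commute)
    qed
    ultimately have "((\<lambda>u. (\<tau> u - ?t) / (u - x)) \<longlongrightarrow> \<sigma> x) ?F"
      by (rule Lim_transform_eventually)
    then show "(\<tau> has_real_derivative \<sigma> x) ?F"
      by (simp add: has_field_derivative_iff)
    \<comment> \<open>The derivative of g in x is close to - |\<gamma>' x|^2, hence nonzero.\<close>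
    have "M * \<bar>?t - x\<bar> \<le> M * \<delta>" using \<tau>(2)[OF x] M by (intro mult_left_mono) auto
    moreover have "norm (\<Phi> ?t - \<gamma> ?t) \<le> \<epsilon>" using close(1) \<tau>(1)[OF x] by (simp add: I_def)
    moreover have "norm (\<Phi> ?t - \<gamma> x) \<le> norm (\<Phi> ?t - \<gamma> ?t) + norm (\<gamma> ?t - \<gamma> x)"
      using norm_triangle_ineq[of "\<Phi> ?t - \<gamma> ?t" "\<gamma> ?t - \<gamma> x"] by simp
    ultimately have "norm (\<Phi> ?t - \<gamma> x) \<le> \<epsilon> + M * \<delta>"
      using lip(1)[of ?t x] by linarith
    then have "\<bar>(\<Phi> ?t - \<gamma> x) \<bullet> \<gamma>'' x\<bar> \<le> (\<epsilon> + M * \<delta>) * M" by (intro CS bd(3))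
    moreover have "(\<epsilon> + M * \<delta>) * M = \<delta> / 4 + 1 / 8" using M\<delta> by (simp add: algebra_simps)
    moreover have "\<gamma>' x \<bullet> \<gamma>' x \<ge> 1" using bd(1)[of x] by (simp add: dot_square_norm)
    ultimately have "?c < 0" using \<open>\<delta> \<le> 1 / 8\<close> by linarith
    then show "\<sigma> x \<noteq> 0" using half by (simp add: \<sigma>_def)
  qed
  have "\<tau> x = x" if "x \<in> {a..b}" "g x x = 0" for x
    using g_expand[of "\<tau> x" x x] \<tau>[OF that(1)] that pos by (auto simp: I_def)
  with \<tau> \<tau>_deriv show ?thesis
    using that[of \<tau> \<sigma>] unfolding I_def g_def by blast
qed

section \<open>A vector field with the curve as a saddle orbit\<close>

definition radius_sq :: "real^3 \<Rightarrow> real" where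
  "radius_sq r = (r $ 1)\<^sup>2 + (r $ 2)\<^sup>2"

text \<open>The horizontal part is \<open>j + m e\<close> with \<open>e = (X, Y)\<close>, \<open>j = (Y, - X)\<close> and \<open>m = (1 - \<sigma>) / 2\<close>, which gives unit angular speed
  and \<open>\<sigma>' = 2 m \<sigma> = \<sigma> (1 - \<sigma>)\<close>. The third component is \<open>w + (X\<^sup>3 + 11 (\<sigma> - 1))'\<close>, which makes \<open>w' = w\<close> for
  \<open>w = Z - X\<^sup>3 - 11 (\<sigma> - 1)\<close>.\<close>

definition drift :: "real^3 \<Rightarrow> real^3" where
  "drift r = vector [
     r $ 2 + (1 - radius_sq r) / 2 * r $ 1,
     - r $ 1 + (1 - radius_sq r) / 2 * r $ 2,
     r $ 3 - r $ 1 ^ 3 - 11 * (radius_sq r - 1)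
       + 3 * (r $ 1)\<^sup>2 * (r $ 2 + (1 - radius_sq r) / 2 * r $ 1) + 11 * (radius_sq r * (1 - radius_sq r))]"

definition drift_deriv :: "real^3 \<Rightarrow> real^3 \<Rightarrow> real^3" where
  "drift_deriv r v =
     (let s = 2 * (r $ 1 * v $ 1 + r $ 2 * v $ 2);
          d = v $ 2 + (1 - radius_sq r) / 2 * v $ 1 - s / 2 * r $ 1
      in vector [
        d,
        - v $ 1 + (1 - radius_sq r) / 2 * v $ 2 - s / 2 * r $ 2,
        v $ 3 - 3 * (r $ 1)\<^sup>2 * v $ 1 - 11 * s
          + 6 * r $ 1 * v $ 1 * drift r $ 1 + 3 * (r $ 1)\<^sup>2 * d + 11 * (1 - 2 * radius_sq r) * s])"

definition accel :: "real^3 \<Rightarrow> real^3" where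
  "accel r = drift_deriv r (drift r)"

lemma drift_nth:
  "drift r $ 1 = r $ 2 + (1 - radius_sq r) / 2 * r $ 1"
  "drift r $ 2 = - r $ 1 + (1 - radius_sq r) / 2 * r $ 2"
  by (simp_all add: drift_def)

lemma has_derivative_drift: "(drift has_derivative drift_deriv r) (at r)"
proof -
  have s: "(radius_sq has_derivative (\<lambda>v. 2 * (r $ 1 * v $ 1 + r $ 2 * v $ 2))) (at r)"
    unfolding radius_sq_def[abs_def] by (auto intro!: derivative_eq_intros simp: algebra_simps)
  show ?thesis
    unfolding drift_def[abs_def] drift_deriv_def Let_def vector_3
    by (rule has_derivative_vector_3;
        auto intro!: derivative_eq_intros s simp: fun_eq_iff field_simps power2_eq_square power3_eq_cube)
qed

lemma scalar_C_drift: "scalar_C k (\<lambda>r. drift r $ 1)" "scalar_C k (\<lambda>r. drift r $ 2)"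
    "scalar_C k (\<lambda>r. drift r $ 3)"
  and scalar_C_radius_sq: "scalar_C k radius_sq"
proof -
  show *: "scalar_C k radius_sq"
    unfolding radius_sq_def[abs_def]
    by (intro scalar_C_add scalar_C_power scalar_C_component)
  show "scalar_C k (\<lambda>r. drift r $ 1)" "scalar_C k (\<lambda>r. drift r $ 2)" "scalar_C k (\<lambda>r. drift r $ 3)"
    unfolding drift_def vector_3 divide_inverse minus_mult_commute
    using scalar_C_diff[OF scalar_C_const[of k 0] scalar_C_component[of k 1]]
    by (intro scalar_C_add scalar_C_diff scalar_C_mult scalar_C_power scalar_C_component
        scalar_C_const *; simp)+
qed

lemma scalar_C_accel: "scalar_C k (\<lambda>r. accel r $ 1)" "scalar_C k (\<lambda>r. accel r $ 2)"
    "scalar_C k (\<lambda>r. accel r $ 3)"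
  unfolding accel_def drift_deriv_def Let_def vector_3 divide_inverse minus_mult_commute
  using scalar_C_diff[OF scalar_C_const[of k 0] scalar_C_drift(1)[of k]]
  by (intro scalar_C_add scalar_C_diff scalar_C_mult scalar_C_power scalar_C_component
        scalar_C_const scalar_C_drift scalar_C_radius_sq; simp)+

lemma drift_along_curve: "drift (curve_jet 0 x) = curve_jet 1 x"
  unfolding curve_jet_0 curve_jet_1 drift_def radius_sq_def by simp

text \<open>The curve is an orbit of the field, so its velocity has derivative \<open>dD(D)\<close>.\<close>

lemma accel_along_curve: "accel (curve_jet 0 x) = curve_jet 2 x"
proof -
  have "((\<lambda>x. drift (curve_jet 0 x)) has_vector_derivative accel (curve_jet 0 x)) (at x)"
    using has_derivative_compose[OF curve_jet_has_vector_derivative[of 0 x, unfolded has_vector_derivative_def]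
        has_derivative_drift[of "curve_jet 0 x"]]
    unfolding has_vector_derivative_def accel_def drift_along_curve
    using linear_scale[OF has_derivative_linear[OF has_derivative_drift]] by simp
  then show ?thesis
    using curve_jet_has_vector_derivative[of 1 x] vector_derivative_unique_at
    unfolding drift_along_curve numeral_2_eq_2 by fastforce
qed

section \<open>The plane field\<close>

text \<open>The polynomial in \<open>\<sigma>\<close> under the positive part is negative for \<open>1/2 < \<sigma> < 3/2\<close>. The exponent \<open>4\<close> makes the
  function of class \<open>C\<^sup>3\<close>, and the factor \<open>25\<close> lets it dominate the third component of the cross product
  for large \<open>\<sigma>\<close>.\<close>

definition bump :: "real^3 \<Rightarrow> real" where
  "bump r = 25 * max 0 ((radius_sq r - 1)\<^sup>2 - 1 / 4) ^ 4"

text \<open>Near the curve this is the normal of the osculating planes of the orbits of \<open>drift\<close>.\<close>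

definition osculating :: "real^3 \<Rightarrow> real^3" where
  "osculating r = cross3 (drift r) (accel r) - vector [0, 0, bump r]"

text \<open>A neighbourhood of the curve on which \<open>bump\<close> vanishes.\<close>

definition tube :: "(real^3) set" where
  "tube = {r. 1 / 2 < radius_sq r \<and> radius_sq r < 3 / 2}"

text \<open>With \<open>V = j + m e\<close> for the horizontal velocity, its derivative along the flow is \<open>J V + m V - m \<sigma> e\<close>, where
  \<open>J\<close> is the clockwise quarter turn, and their cross product is \<open>- \<sigma> (1 + m\<^sup>2 + m \<sigma>)\<close>. This is
  \<open>- \<sigma> (5 - \<sigma>\<^sup>2) / 4\<close>.\<close>

lemma osculating_nth_3:
  "osculating r $ 3 = - (radius_sq r * (5 - (radius_sq r)\<^sup>2) / 4 + bump r)"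
proof -
  let ?X = "r $ 1" and ?Y = "r $ 2" and ?V = "drift r $ 1" and ?W = "drift r $ 2"
  define m where "m = (1 - radius_sq r) / 2"
  have V: "?V = ?Y + m * ?X" and W: "?W = - ?X + m * ?Y" by (simp_all add: drift_nth m_def)
  have s: "radius_sq r = ?X * ?X + ?Y * ?Y" by (simp add: radius_sq_def power2_eq_square)
  have radial: "?X * ?V + ?Y * ?W = m * radius_sq r" and speed: "?V * ?V + ?W * ?W = (1 + m * m) * radius_sq r"
    and angular: "?V * ?Y - ?W * ?X = radius_sq r"
    unfolding V W s by (simp_all add: algebra_simps)
  have acc: "accel r $ 1 = ?W + m * ?V - m * radius_sq r * ?X" "accel r $ 2 = - ?V + m * ?W - m * radius_sq r * ?Y"
    by (simp_all add: accel_def drift_deriv_def Let_def radial m_def[symmetric])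
  have "osculating r $ 3 = - (?V * ?V + ?W * ?W) - m * radius_sq r * (?V * ?Y - ?W * ?X) - bump r"
    by (simp add: osculating_def cross3_def acc algebra_simps)
  then show ?thesis
    unfolding speed angular by (simp add: m_def field_simps power2_eq_square)
qed

text \<open>For \<open>0 < \<sigma> < \<surd>5\<close> the polynomial part of the third component does not vanish and the bump has the same
  sign. The bump takes over at \<open>\<sigma> = 0\<close> and for large \<open>\<sigma>\<close>; \<open>11 / 5\<close> is a rational number just below
  \<open>\<surd>5\<close>.\<close>

lemma osculating_nonzero: "osculating r \<noteq> 0"
proof -
  define s where "s = radius_sq r"
  have "s \<ge> 0" by (simp add: s_def radius_sq_def)
  have "s * (5 - s\<^sup>2) / 4 + 25 * max 0 ((s - 1)\<^sup>2 - 1 / 4) ^ 4 > 0"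
  proof (cases "s \<le> 11 / 5")
    case True
    show ?thesis
    proof (cases "s = 0")
      case False
      have "s\<^sup>2 \<le> (11 / 5)\<^sup>2" using True \<open>s \<ge> 0\<close> by (intro power_mono)
      then have "s * (5 - s\<^sup>2) > 0" using False \<open>s \<ge> 0\<close> by (simp add: power2_eq_square)
      then show ?thesis by (intro add_pos_nonneg) auto
    qed (simp add: power2_eq_square)
  next
    case False
    let ?q = "(s - 1)\<^sup>2 - 1 / 4"
    \<comment> \<open>This product bounds ?q - s^2 / 5 from below, up to a positive factor.\<close>
    have "(s - 11 / 5) * (s - 3 / 10) \<ge> 0" using False by simp
    then have q: "?q \<ge> s\<^sup>2 / 5" using False
      by (simp add: power2_eq_square algebra_simps)
    have "(6 / 5)\<^sup>2 \<le> (s - 1)\<^sup>2" using False by (intro power_mono) auto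
    then have q1: "?q \<ge> 1" by (simp add: power2_eq_square)
    have "s ^ 3 \<le> s ^ 4" using False by (intro power_increasing) auto
    also have "s ^ 4 = 25 * (s\<^sup>2 / 5)\<^sup>2" by (simp add: power_divide flip: power_mult)
    also have "(s\<^sup>2 / 5)\<^sup>2 \<le> ?q\<^sup>2" using q by (intro power_mono) auto
    also have "?q\<^sup>2 \<le> ?q ^ 4" using q1 by (intro power_increasing) auto
    finally have "s ^ 3 \<le> 25 * max 0 ?q ^ 4" using q1 by (simp add: max_def)
    moreover have "s * (5 - s\<^sup>2) / 4 = 5 * s / 4 - s ^ 3 / 4"
      by (simp add: algebra_simps power2_eq_square power3_eq_cube diff_divide_distrib)
    moreover have "s ^ 3 \<ge> 0" "s > 0" using False by auto
    ultimately show ?thesis by linarith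
  qed
  then have "osculating r $ 3 \<noteq> 0" unfolding osculating_nth_3 bump_def s_def by linarith
  then show ?thesis by auto
qed

lemma class_C_osculating: "class_C 3 osculating"
proof -
  have "scalar_C 3 (\<lambda>r. max 0 ((radius_sq r - 1)\<^sup>2 - 1 / 4) ^ (3 + 1))"
    by (intro scalar_C_pos_part_power scalar_C_diff scalar_C_power scalar_C_radius_sq scalar_C_const)
  then have b: "scalar_C 3 bump"
    unfolding bump_def[abs_def] by (intro scalar_C_mult scalar_C_const) simp
  have "osculating = (\<lambda>r. vector [
      drift r $ 2 * accel r $ 3 - drift r $ 3 * accel r $ 2,
      drift r $ 3 * accel r $ 1 - drift r $ 1 * accel r $ 3,
      drift r $ 1 * accel r $ 2 - drift r $ 2 * accel r $ 1 - bump r])"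
    by (simp add: osculating_def cross3_def fun_eq_iff vec_eq_iff forall_3)
  then show ?thesis
    by (elim ssubst) (intro class_C_vector_3 scalar_C_diff scalar_C_mult scalar_C_drift
        scalar_C_accel b)
qed

lemma plane_field_osculating: "plane_field osculating"
  using class_C_osculating osculating_nonzero unfolding plane_field_def by blast

lemma has_derivative_osculating: "(osculating has_derivative frechet_derivative osculating (at r)) (at r)"
  using class_C_osculating unfolding numeral_3_eq_3
  by (auto simp: differentiable_on_def frechet_derivative_works)

lemma open_tube: "open tube"
proof -
  have "continuous_on UNIV radius_sq" using scalar_C_radius_sq[of 0] by simp
  then show ?thesis
    unfolding tube_def by (intro open_Collect_conj open_Collect_less continuous_on_const)
qed

lemma radius_sq_curve: "radius_sq (curve_jet 0 x) = 1"
  by (simp add: radius_sq_def curve_jet_0)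

lemma curve_in_tube: "curve_jet 0 x \<in> tube"
  by (simp add: tube_def radius_sq_curve)

lemma osculating_in_tube:
  assumes "r \<in> tube"
  shows "osculating r = cross3 (drift r) (accel r)"
proof -
  have "\<bar>radius_sq r - 1\<bar> \<le> 1 / 2" using assms by (simp add: tube_def abs_if)
  then have "(radius_sq r - 1)\<^sup>2 \<le> (1 / 2)\<^sup>2" by (metis abs_ge_zero power2_abs power_mono)
  then have "bump r = 0" by (simp add: bump_def power2_eq_square)
  then show ?thesis by (simp add: osculating_def vec_eq_iff forall_3)
qed

lemma osculating_orthogonal:
  assumes "r \<in> tube"
  shows "osculating r \<bullet> drift r = 0" "osculating r \<bullet> accel r = 0"
  by (simp_all add: osculating_in_tube[OF assms] dot_cross_self)

text \<open>Differentiate \<open>\<langle>\<xi>, D\<rangle> = 0\<close>.\<close>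

lemma osculating_deriv_inner_drift:
  assumes "r \<in> tube"
  shows "frechet_derivative osculating (at r) v \<bullet> drift r = - (osculating r \<bullet> drift_deriv r v)"
proof -
  have "((\<lambda>r. osculating r \<bullet> drift r) has_derivative
          (\<lambda>v. osculating r \<bullet> drift_deriv r v + frechet_derivative osculating (at r) v \<bullet> drift r)) (at r)"
    by (intro has_derivative_inner has_derivative_osculating has_derivative_drift)
  moreover have "((\<lambda>r. osculating r \<bullet> drift r) has_derivative (\<lambda>v. 0)) (at r)"
    by (rule has_derivative_transform_within_open[OF has_derivative_const open_tube assms])
       (simp add: osculating_orthogonal)
  ultimately have "(\<lambda>v. osculating r \<bullet> drift_deriv r v + frechet_derivative osculating (at r) v \<bullet> drift r) = (\<lambda>v. 0)"
    by (rule has_derivative_unique)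
  from fun_cong[OF this, of v] show ?thesis by simp
qed

lemma drift_nonzero:
  assumes "r \<in> tube"
  shows "drift r \<noteq> 0"
proof
  assume "drift r = 0"
  then have "drift r $ 1 = 0" "drift r $ 2 = 0" by simp_all
  then have "r $ 2 * drift r $ 1 - r $ 1 * drift r $ 2 = 0" by simp
  then have "radius_sq r = 0" by (simp add: drift_nth radius_sq_def algebra_simps power2_eq_square)
  with assms show False by (simp add: tube_def)
qed

text \<open>By the preceding lemma \<open>\<langle>d\<xi>(D), D\<rangle> = - \<langle>\<xi>, dD(D)\<rangle>\<close>, and \<open>dD(D)\<close> is the acceleration, which lies in the
  plane.\<close>

lemma asymptotic_direction_drift:
  assumes "r \<in> tube"
  shows "asymptotic_direction osculating r (drift r)"
  unfolding asymptotic_direction_def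
  using drift_nonzero[OF assms] osculating_orthogonal[OF assms] osculating_deriv_inner_drift[OF assms]
  by (simp add: accel_def[symmetric])

text \<open>The mixed coefficient for \<open>u = D = \<gamma>'\<close> and \<open>v = A = \<gamma>''\<close> has two parts. Differentiating \<open>\<langle>\<xi>(\<gamma>), \<gamma>''\<rangle> = 0\<close> gives
  \<open>\<langle>d\<xi>(\<gamma>'), \<gamma>''\<rangle> = - \<langle>\<xi>, \<gamma>'''\<rangle>\<close>, and differentiating \<open>\<langle>\<xi>, D\<rangle> = 0\<close> gives \<open>\<langle>d\<xi>(A), D\<rangle> = - \<langle>\<xi>, dD(A)\<rangle>\<close>.\<close>

lemma curve_not_parabolic: "\<not> parabolic_point osculating (curve_jet 0 x)"
proof (rule not_parabolic_pointI)
  let ?r = "curve_jet 0 x"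
  note tube = curve_in_tube[of x]
  let ?L = "frechet_derivative osculating (at ?r)"
  show "linear ?L" using has_derivative_linear[OF has_derivative_osculating] .
  show "asymptotic_direction osculating ?r (drift ?r)" by (rule asymptotic_direction_drift[OF tube])
  show "osculating ?r \<bullet> accel ?r = 0" by (rule osculating_orthogonal[OF tube])
  have "((\<lambda>t. osculating (curve_jet 0 t) \<bullet> curve_jet 2 t) has_vector_derivative
          osculating ?r \<bullet> curve_jet 3 x + ?L (curve_jet 1 x) \<bullet> curve_jet 2 x) (at x)"
    using has_derivative_inner[OF has_derivative_compose[OF
          curve_jet_has_vector_derivative[of 0 x, unfolded has_vector_derivative_def]
          has_derivative_osculating[of ?r]]
        curve_jet_has_vector_derivative[of 2 x, unfolded has_vector_derivative_def]]
      linear_scale[OF \<open>linear ?L\<close>]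
    by (simp add: has_vector_derivative_def numeral_3_eq_3 numeral_2_eq_2 algebra_simps)
  moreover have "osculating (curve_jet 0 t) \<bullet> curve_jet 2 t = 0" for t
    using osculating_orthogonal(2)[OF curve_in_tube] by (simp add: accel_along_curve)
  ultimately have "osculating ?r \<bullet> curve_jet 3 x + ?L (curve_jet 1 x) \<bullet> curve_jet 2 x = 0"
    by (simp only:) (rule vector_derivative_unique_at[OF _ has_vector_derivative_const])
  then have "?L (drift ?r) \<bullet> accel ?r + ?L (accel ?r) \<bullet> drift ?r
      = - (osculating ?r \<bullet> (curve_jet 3 x + drift_deriv ?r (curve_jet 2 x)))"
    using osculating_deriv_inner_drift[OF tube, of "curve_jet 2 x"]
    by (simp add: drift_along_curve accel_along_curve inner_add_right)
  also have "\<dots> = 44 + 12 * sin x * (cos x)\<^sup>2 + 6 * cos x ^ 3 - 24 * (sin x)\<^sup>2 * cos x"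
  proof -
    let ?s = "sin x" and ?c = "cos x"
    \<comment> \<open>The derivative of \<sigma> in the direction of the second derivative of the curve.\<close>
    have radial: "2 * (?r $ 1 * curve_jet 2 x $ 1 + ?r $ 2 * curve_jet 2 x $ 2) = - 2"
      unfolding curve_jet_0 curve_jet_2 vector_3 using sin_cos_squared_add[of x] by algebra
    have acc: "drift_deriv ?r (curve_jet 2 x)
        = vector [?s - ?c, ?s + ?c, 6 * ?s * ?c\<^sup>2 + 3 * ?s ^ 3 + 44 - 9 * ?s\<^sup>2 * ?c]"
      unfolding drift_deriv_def radial Let_def drift_along_curve radius_sq_curve
      unfolding curve_jet_0 curve_jet_1 curve_jet_2 vector_3
      by (simp add: vec_eq_iff forall_3 power2_eq_square power3_eq_cube algebra_simps)
    have pl: "osculating ?r = vector [3 * ?s ^ 4 - 3 * ?s\<^sup>2 * ?c\<^sup>2, - 6 * ?s * ?c ^ 3, - 1]"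
      unfolding osculating_in_tube[OF tube] drift_along_curve accel_along_curve
      unfolding curve_jet_1 curve_jet_2 cross3_def vector_3
      using sin_cos_squared_add[of x]
      by (simp add: vec_eq_iff forall_3 power2_eq_square power3_eq_cube power4_eq_xxxx algebra_simps)
    \<comment> \<open>An identity of polynomials in the sine and the cosine; the right-hand side vanishes by the
      Pythagorean identity.\<close>
    have "osculating ?r \<bullet> (curve_jet 3 x + drift_deriv ?r (curve_jet 2 x))
        + (44 + 12 * ?s * ?c\<^sup>2 + 6 * ?c ^ 3 - 24 * ?s\<^sup>2 * ?c)
        = (6 * ?s\<^sup>2 * ?c + 6 * ?s * ?c\<^sup>2 - 3 * ?s ^ 3) * (1 - (?s\<^sup>2 + ?c\<^sup>2))"
      unfolding pl acc curve_jet_3 inner_real_3 vector_add_component vector_3 by algebra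
    then show ?thesis by simp
  qed
  also have "\<dots> > 0"
  proof -
    have "\<bar>sin x * (cos x)\<^sup>2\<bar> \<le> 1 * 1" "\<bar>cos x ^ 3\<bar> \<le> 1" "\<bar>(sin x)\<^sup>2 * cos x\<bar> \<le> 1 * 1"
      unfolding abs_mult power_abs by (intro mult_mono power_le_one abs_sin_le_one abs_cos_le_one; simp)+
    then show ?thesis by (simp add: abs_le_iff mult.assoc)
  qed
  finally show "?L (drift ?r) \<bullet> accel ?r + ?L (accel ?r) \<bullet> drift ?r \<noteq> 0" by simp
qed

section \<open>The flow\<close>

text \<open>The solution of \<open>\<rho>' = \<rho> (1 - \<rho>\<^sup>2) / 2\<close> with \<open>1 / \<rho>(0)\<^sup>2 = 1 + c\<close>.\<close>

definition orbit_radius :: "real \<Rightarrow> real \<Rightarrow> real" where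
  "orbit_radius c t = 1 / sqrt (1 + c * exp (- t))"

definition flow :: "real \<Rightarrow> real \<Rightarrow> real \<Rightarrow> real^3" where
  "flow c w t = vector [orbit_radius c t * sin t, orbit_radius c t * cos t,
     w * exp t + (orbit_radius c t * sin t) ^ 3 + 11 * ((orbit_radius c t)\<^sup>2 - 1)]"

lemma orbit_radius_squared: "1 + c * exp (- t) > 0 \<Longrightarrow> (orbit_radius c t)\<^sup>2 = 1 / (1 + c * exp (- t))"
  by (simp add: orbit_radius_def power_divide)

lemma orbit_radius_deriv:
  assumes "1 + c * exp (- t) > 0"
  shows "(orbit_radius c has_real_derivative (1 - (orbit_radius c t)\<^sup>2) / 2 * orbit_radius c t) (at t)"
proof -
  let ?q = "1 + c * exp (- t)"
  have q: "sqrt ?q > 0" "sqrt ?q * sqrt ?q = ?q" using assms by simp_all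
  have "(orbit_radius c has_real_derivative (c * exp (- t)) / (2 * sqrt ?q) / (sqrt ?q * sqrt ?q)) (at t)"
    unfolding orbit_radius_def[abs_def] using assms
    by (auto intro!: derivative_eq_intros simp: field_simps)
  moreover have "(1 - (orbit_radius c t)\<^sup>2) / 2 * orbit_radius c t
      = (c * exp (- t)) / (2 * sqrt ?q) / (sqrt ?q * sqrt ?q)"
    unfolding q(2) orbit_radius_squared[OF assms] using assms by (simp add: orbit_radius_def field_simps)
  ultimately show ?thesis by (simp only:)
qed

lemma radius_sq_flow: "radius_sq (flow c w t) = (orbit_radius c t)\<^sup>2"
proof -
  have "radius_sq (flow c w t) = (orbit_radius c t)\<^sup>2 * ((sin t)\<^sup>2 + (cos t)\<^sup>2)"
    unfolding radius_sq_def flow_def vector_3 by (simp only: power_mult_distrib distrib_left)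
  then show ?thesis by simp
qed

lemma flow_deriv:
  assumes "1 + c * exp (- t) > 0"
  shows "(flow c w has_vector_derivative drift (flow c w t)) (at t)"
proof -
  let ?g = "orbit_radius c t"
  note g = orbit_radius_deriv[OF assms]
  let ?V = "?g * cos t + (1 - ?g\<^sup>2) / 2 * ?g * sin t"
  have V: "((\<lambda>t. orbit_radius c t * sin t) has_real_derivative ?V) (at t)"
    by (auto intro!: derivative_eq_intros g)
  have W: "((\<lambda>t. orbit_radius c t * cos t) has_real_derivative - ?g * sin t + (1 - ?g\<^sup>2) / 2 * ?g * cos t) (at t)"
    by (auto intro!: derivative_eq_intros g)
  have "((\<lambda>t. w * exp t + (orbit_radius c t * sin t) ^ 3 + 11 * ((orbit_radius c t)\<^sup>2 - 1)) has_real_derivative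
      w * exp t + 3 * (?g * sin t)\<^sup>2 * ?V + 11 * (2 * ?g * ((1 - ?g\<^sup>2) / 2 * ?g))) (at t)"
    by (auto intro!: derivative_eq_intros V g)
  from has_vector_derivative_vector_3[OF V W this]
  have "(flow c w has_vector_derivative vector [?V, - ?g * sin t + (1 - ?g\<^sup>2) / 2 * ?g * cos t,
      w * exp t + 3 * (?g * sin t)\<^sup>2 * ?V + 11 * (2 * ?g * ((1 - ?g\<^sup>2) / 2 * ?g))]) (at t)"
    by (simp add: flow_def[abs_def])
  also have "vector [?V, - ?g * sin t + (1 - ?g\<^sup>2) / 2 * ?g * cos t,
      w * exp t + 3 * (?g * sin t)\<^sup>2 * ?V + 11 * (2 * ?g * ((1 - ?g\<^sup>2) / 2 * ?g))] = drift (flow c w t)"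
    unfolding drift_def radius_sq_flow unfolding flow_def vec_eq_iff forall_3 vector_3
    by (simp add: field_simps power2_eq_square)
  finally show ?thesis .
qed

lemma flow_at_curve: "flow 0 0 = curve_jet 0"
  by (simp add: flow_def orbit_radius_def curve_jet_0 fun_eq_iff)

text \<open>The time interval starts at \<open>- 1\<close> to leave room for the shift of the parameter at the beginning of the
  period.\<close>

lemma flow_denominator:
  fixes c :: real
  assumes "\<bar>c\<bar> \<le> 1 / 12" "t \<ge> - 1"
  shows "\<bar>c * exp (- t)\<bar> \<le> 1 / 4"
proof -
  have "exp (- t) \<le> exp 1" using assms by simp
  then have "exp (- t) \<le> 3" using exp_le by linarith
  then have "\<bar>c\<bar> * exp (- t) \<le> 1 / 12 * 3" using assms by (intro mult_mono) auto
  then show ?thesis by (simp add: abs_mult)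
qed

lemma flow_denominator_pos:
  fixes c :: real
  assumes "\<bar>c\<bar> \<le> 1 / 12" "t \<ge> - 1"
  shows "1 + c * exp (- t) > 0"
  using flow_denominator[OF assms] by linarith

lemma flow_in_tube:
  fixes c :: real
  assumes "\<bar>c\<bar> \<le> 1 / 12" "t \<ge> - 1"
  shows "flow c w t \<in> tube"
proof -
  have "3 / 4 \<le> 1 + c * exp (- t)" "1 + c * exp (- t) \<le> 5 / 4"
    using flow_denominator[OF assms] by (auto simp: abs_le_iff)
  then show ?thesis
    unfolding tube_def using flow_denominator_pos[OF assms]
    by (simp add: radius_sq_flow orbit_radius_squared field_simps)
qed

text \<open>Uniform continuity on a compact set turns continuous dependence on a parameter into uniform closeness.\<close>

lemma eventually_uniformly_close:
  fixes F :: "'a::heine_borel \<Rightarrow> 'b::metric_space \<Rightarrow> 'c::metric_space"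
  assumes cont: "continuous_on (cball a r \<times> T) (\<lambda>(q, t). F q t)"
    and "compact T" "r > 0" "e > 0"
  shows "\<forall>\<^sub>F q in nhds a. \<forall>t\<in>T. dist (F q t) (F a t) < e"
proof -
  have "uniformly_continuous_on (cball a r \<times> T) (\<lambda>(q, t). F q t)"
    by (intro compact_uniformly_continuous cont compact_Times compact_cball assms)
  then obtain d where d: "d > 0"
    "\<And>x y. x \<in> cball a r \<times> T \<Longrightarrow> y \<in> cball a r \<times> T \<Longrightarrow> dist y x < d \<Longrightarrow>
      dist ((\<lambda>(q, t). F q t) y) ((\<lambda>(q, t). F q t) x) < e"
    using \<open>e > 0\<close> unfolding uniformly_continuous_on_def by metis
  have "\<forall>\<^sub>F q in nhds a. dist q a < min d r"
    unfolding eventually_nhds_metric using d(1) \<open>r > 0\<close> by (intro exI[of _ "min d r"]) auto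
  then show ?thesis
  proof eventually_elim
    case (elim q)
    show ?case
    proof
      fix t assume "t \<in> T"
      then show "dist (F q t) (F a t) < e"
        using d(2)[of "(a, t)" "(q, t)"] elim \<open>r > 0\<close>
        by (simp add: dist_Pair_Pair dist_commute)
    qed
  qed
qed

lemma continuous_on_drift: "continuous_on S drift"
  using has_derivative_drift has_derivative_continuous continuous_at_imp_continuous_on by blast

lemma eventually_flow_close:
  assumes "e > 0"
  shows "\<forall>\<^sub>F q in nhds (0, 0). \<bar>fst q\<bar> \<le> 1 / 12 \<and> (\<forall>t\<in>{- 1..9}.
    norm (flow (fst q) (snd q) t - curve_jet 0 t) < e \<and>
    norm (drift (flow (fst q) (snd q) t) - curve_jet 1 t) < e)"
proof -
  let ?K = "cball (0, 0) (1 / 12) \<times> {- 1..9} :: ((real \<times> real) \<times> real) set"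
  have small: "\<bar>fst q\<bar> \<le> 1 / 12" if "q \<in> cball (0, 0) (1 / 12)" for q :: "real \<times> real"
    using that dist_fst_le[of "(0, 0)" q] by (auto simp: dist_real_def)
  have "1 + fst (fst x) * exp (- snd x) > 0" if "x \<in> ?K" for x
    using that by (intro flow_denominator_pos small) auto
  then have "\<forall>x\<in>?K. sqrt (1 + fst (fst x) * exp (- snd x)) \<noteq> 0" by fastforce
  then have cont: "continuous_on ?K (\<lambda>(q, t). flow (fst q) (snd q) t)"
    unfolding flow_def orbit_radius_def case_prod_beta by (intro continuous_intros)
  then have "continuous_on ?K (\<lambda>(q, t). drift (flow (fst q) (snd q) t))"
    unfolding case_prod_beta by (intro continuous_on_compose2[OF continuous_on_drift]) auto
  from eventually_uniformly_close[OF cont _ _ assms] eventually_uniformly_close[OF this _ _ assms]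
  have "\<forall>\<^sub>F q in nhds (0, 0). \<forall>t\<in>{- 1..9}.
      dist (flow (fst q) (snd q) t) (flow (fst (0, 0)) (snd (0, 0)) t) < e"
    "\<forall>\<^sub>F q in nhds (0, 0). \<forall>t\<in>{- 1..9}.
      dist (drift (flow (fst q) (snd q) t)) (drift (flow (fst (0, 0)) (snd (0, 0)) t)) < e"
    by auto
  moreover have "\<forall>\<^sub>F q in nhds (0, 0 :: real). \<bar>fst q\<bar> \<le> (1 / 12 :: real)"
    by (rule eventually_mono[OF eventually_nhds_in_open[of "ball (0 :: real, 0 :: real) (1 / 12)"]])
       (use small ball_subset_cball in auto)
  ultimately show ?thesis
    by eventually_elim (auto simp: flow_at_curve drift_along_curve dist_norm)
qed

section \<open>The first return map\<close>

text \<open>The second normal vector has third component \<open>- 1\<close> and its horizontal part is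
  \<open>f'(x)\<close> times the unit tangent of the circle, for \<open>f = sin\<^sup>3\<close>.\<close>

lemma tubular_coordinates_curve:
  "tubular_coordinates (curve_jet 0) x y z = vector [
     (1 - y) * sin x + z * (3 * (sin x)\<^sup>2 * cos x) * cos x,
     (1 - y) * cos x - z * (3 * (sin x)\<^sup>2 * cos x) * sin x,
     sin x ^ 3 - z]"
proof -
  have trig: "cos x * - cos x - - sin x * - sin x = - 1"
    using sin_cos_squared_add3[of x] by algebra
  show ?thesis
    unfolding tubular_coordinates_def curve_deriv_eq_curve_jet Let_def cross3_def
      curve_jet_0 curve_jet_1 vector_3 trig
    by (simp add: vec_eq_iff forall_3 algebra_simps)
qed

text \<open>In the normal plane at \<open>x\<close> the radial component determines \<open>y\<close> and the height determines \<open>z\<close>; the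
  condition of the plane says that the tangential component is then right as well.\<close>

lemma tubular_coordinates_section:
  assumes "(p - curve_jet 0 x) \<bullet> curve_jet 1 x = 0"
  shows "tubular_coordinates (curve_jet 0) x (1 - (p $ 1 * sin x + p $ 2 * cos x)) (sin x ^ 3 - p $ 3) = p"
proof -
  have z: "(sin x ^ 3 - p $ 3) * (3 * (sin x)\<^sup>2 * cos x) = p $ 1 * cos x - p $ 2 * sin x"
    using assms unfolding inner_real_3 curve_jet_0 curve_jet_1 vector_minus_component vector_3
    by (simp add: algebra_simps)
  have "(p $ 1 * sin x + p $ 2 * cos x) * sin x + (p $ 1 * cos x - p $ 2 * sin x) * cos x = p $ 1"
    "(p $ 1 * sin x + p $ 2 * cos x) * cos x - (p $ 1 * cos x - p $ 2 * sin x) * sin x = p $ 2"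
    using sin_cos_squared_add[of x] by algebra+
  then show ?thesis
    unfolding tubular_coordinates_curve z by (simp add: vec_eq_iff forall_3)
qed

lemma curve_jet_bounds: "1 \<le> norm (curve_jet 1 x)" "norm (curve_jet 1 x) \<le> 10" "norm (curve_jet 2 x) \<le> 10"
proof -
  let ?s = "sin x" and ?c = "cos x"
  have sc: "?s\<^sup>2 + ?c\<^sup>2 = 1" "\<bar>?s\<bar> \<le> 1" "\<bar>?c\<bar> \<le> 1" by simp_all
  have 1: "norm (curve_jet 1 x) = sqrt (1 + (3 * ?s\<^sup>2 * ?c)\<^sup>2)"
    unfolding norm_real_3 curve_jet_1 vector_3 using sc(1) by (simp add: add.commute)
  have 2: "norm (curve_jet 2 x) = sqrt (1 + (6 * ?s * ?c\<^sup>2 - 3 * ?s ^ 3)\<^sup>2)"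
    unfolding norm_real_3 curve_jet_2 vector_3 using sc(1) by simp
  show "1 \<le> norm (curve_jet 1 x)" unfolding 1 by simp
  have b: "\<bar>?s\<^sup>2 * ?c\<bar> \<le> 1 * 1" "\<bar>?s * ?c\<^sup>2\<bar> \<le> 1 * 1" "\<bar>?s ^ 3\<bar> \<le> 1"
    unfolding abs_mult power_abs by (intro mult_mono power_le_one sc; simp)+
  have "\<bar>3 * ?s\<^sup>2 * ?c\<bar> \<le> 9" "\<bar>6 * ?s * ?c\<^sup>2 - 3 * ?s ^ 3\<bar> \<le> 9"
    using b by (simp_all add: abs_le_iff algebra_simps)
  then have "(3 * ?s\<^sup>2 * ?c)\<^sup>2 \<le> 9\<^sup>2" "(6 * ?s * ?c\<^sup>2 - 3 * ?s ^ 3)\<^sup>2 \<le> 9\<^sup>2"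
    by (metis abs_ge_zero power2_abs power_mono)+
  then show "norm (curve_jet 1 x) \<le> 10" "norm (curve_jet 2 x) \<le> 10"
    unfolding 1 2 by (intro real_le_lsqrt; simp)+
qed

text \<open>The orbit through the point with tubular coordinates \<open>(0, y, z)\<close>, which is \<open>(0, 1 - y, - z)\<close> in space, is
  \<open>flow (radial_parameter y) (vertical_parameter y z)\<close>.\<close>

definition radial_parameter :: "real \<Rightarrow> real" where
  "radial_parameter y = 1 / (1 - y)\<^sup>2 - 1"

definition vertical_parameter :: "real \<Rightarrow> real \<Rightarrow> real" where
  "vertical_parameter y z = - z - 11 * ((1 - y)\<^sup>2 - 1)"

definition return_map :: "real^2 \<Rightarrow> real^2" where
  "return_map p = vector [1 - orbit_radius (radial_parameter (p $ 1)) (2 * pi),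
     - (vertical_parameter (p $ 1) (p $ 2) * exp (2 * pi) + 11 * ((orbit_radius (radial_parameter (p $ 1)) (2 * pi))\<^sup>2 - 1))]"

text \<open>Reparametrize the orbit by the normal planes. The bound \<open>10\<close> on the first two derivatives of the curve
  yields the tolerance \<open>1 / (32 * 10 ^ 3)\<close>. At time \<open>0\<close> and \<open>2 \<pi>\<close> the orbit has
  angle \<open>0\<close>, so it lies in the corresponding normal plane and keeps its parameter there.\<close>

lemma flow_integral_curve:
  assumes c: "\<bar>c\<bar> \<le> 1 / 12"
    and close: "\<And>t. t \<in> {- 1..9} \<Longrightarrow> norm (flow c w t - curve_jet 0 t) < 1 / 32000"
      "\<And>t. t \<in> {- 1..9} \<Longrightarrow> norm (drift (flow c w t) - curve_jet 1 t) < 1 / 32000"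
  obtains y z where "integral_curve (curve_jet 0) tube drift (2 * pi) y z"
    "y 0 = 1 - orbit_radius c 0" "z 0 = - (w + 11 * ((orbit_radius c 0)\<^sup>2 - 1))"
    "y (2 * pi) = 1 - orbit_radius c (2 * pi)"
    "z (2 * pi) = - (w * exp (2 * pi) + 11 * ((orbit_radius c (2 * pi))\<^sup>2 - 1))"
proof -
  let ?\<Phi> = "flow c w" and ?l = "2 * pi"
  have sub: "{0 - 1 / (8 * 10\<^sup>2)..?l + 1 / (8 * 10\<^sup>2)} \<subseteq> {- 1..9}"
    using pi_less_4 by auto
  have der: "(?\<Phi> has_vector_derivative drift (?\<Phi> t)) (at t)" if "t \<in> {- 1..9}" for t
    using that by (intro flow_deriv flow_denominator_pos c) auto
  obtain \<tau> \<sigma> where \<tau>: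
    "\<And>x. x \<in> {0..?l} \<Longrightarrow> \<tau> x \<in> {0 - 1 / (8 * 10\<^sup>2)..?l + 1 / (8 * 10\<^sup>2)} \<and>
        (?\<Phi> (\<tau> x) - curve_jet 0 x) \<bullet> curve_jet 1 x = 0"
    "\<And>x. x \<in> {0..?l} \<Longrightarrow> (\<tau> has_real_derivative \<sigma> x) (at x within {0..?l}) \<and> \<sigma> x \<noteq> 0"
    "\<And>x. x \<in> {0..?l} \<Longrightarrow> (?\<Phi> x - curve_jet 0 x) \<bullet> curve_jet 1 x = 0 \<Longrightarrow> \<tau> x = x"
  proof (rule section_reparametrization[of 10 "curve_jet 0" "curve_jet 1" "curve_jet 2" 0 ?l ?\<Phi>
        "\<lambda>t. drift (?\<Phi> t)"])
    show "norm (?\<Phi> t - curve_jet 0 t) \<le> 1 / (32 * 10 ^ 3)"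
      "norm (drift (?\<Phi> t) - curve_jet 1 t) \<le> 1 / (32 * 10 ^ 3)"
      "(?\<Phi> has_vector_derivative drift (?\<Phi> t)) (at t)"
      if "t \<in> {0 - 1 / (8 * 10\<^sup>2)..?l + 1 / (8 * 10\<^sup>2)}" for t
      using close[of t] der[of t] sub that by auto
  qed (use curve_jet_bounds curve_jet_has_vector_derivative[of 0] curve_jet_has_vector_derivative[of 1]
      in \<open>auto simp: numeral_2_eq_2\<close>)
  have \<tau>_range: "\<tau> x \<in> {- 1..9}" if "x \<in> {0..?l}" for x
    using \<tau>(1)[OF that] sub by blast
  define y where "y x = 1 - (?\<Phi> (\<tau> x) $ 1 * sin x + ?\<Phi> (\<tau> x) $ 2 * cos x)" for x
  define z where "z x = sin x ^ 3 - ?\<Phi> (\<tau> x) $ 3" for x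
  have tub: "tubular_coordinates (curve_jet 0) x (y x) (z x) = ?\<Phi> (\<tau> x)" if "x \<in> {0..?l}" for x
    unfolding y_def z_def using tubular_coordinates_section \<tau>(1)[OF that] by blast
  have vel: "((\<lambda>x. ?\<Phi> (\<tau> x)) has_vector_derivative \<sigma> x *\<^sub>R drift (?\<Phi> (\<tau> x))) (at x within {0..?l})"
    if "x \<in> {0..?l}" for x
    using vector_diff_chain_within[of \<tau> "\<sigma> x" x "{0..?l}" ?\<Phi> "drift (?\<Phi> (\<tau> x))"]
      \<tau>(2)[OF that] has_vector_derivative_at_within[OF der[OF \<tau>_range[OF that]]]
    by (simp add: o_def has_real_derivative_iff_has_vector_derivative)
  have comp: "(\<lambda>x. ?\<Phi> (\<tau> x) $ i) differentiable at x within {0..?l}" if "x \<in> {0..?l}" for x i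
    using has_derivative_vec_nth[OF vel[OF that, unfolded has_vector_derivative_def]]
    by (rule differentiableI)
  have trig: "sin differentiable at x within S" "cos differentiable at x within S" for x :: real and S
    using DERIV_sin DERIV_cos has_field_derivative_imp_has_derivative has_derivative_at_withinI
    by (blast intro: differentiableI)+
  have "y differentiable_on {0..?l}" "z differentiable_on {0..?l}"
    unfolding y_def[abs_def] z_def[abs_def] differentiable_on_def
    by (intro ballI derivative_intros comp trig; simp)+
  moreover have "tubular_coordinates (curve_jet 0) x (y x) (z x) \<in> tube \<and>
      (\<exists>s. s \<noteq> 0 \<and> ((\<lambda>t. tubular_coordinates (curve_jet 0) t (y t) (z t)) has_vector_derivative
          s *\<^sub>R drift (tubular_coordinates (curve_jet 0) x (y x) (z x))) (at x within {0..?l}))"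
    if x: "x \<in> {0..?l}" for x
  proof
    show "tubular_coordinates (curve_jet 0) x (y x) (z x) \<in> tube"
      unfolding tub[OF x] using \<tau>_range[OF x] by (intro flow_in_tube c) auto
    have "((\<lambda>t. tubular_coordinates (curve_jet 0) t (y t) (z t)) has_vector_derivative
          \<sigma> x *\<^sub>R drift (?\<Phi> (\<tau> x))) (at x within {0..?l})"
      using has_vector_derivative_transform[OF x tub vel[OF x]] .
    then show "\<exists>s. s \<noteq> 0 \<and> ((\<lambda>t. tubular_coordinates (curve_jet 0) t (y t) (z t)) has_vector_derivative
          s *\<^sub>R drift (tubular_coordinates (curve_jet 0) x (y x) (z x))) (at x within {0..?l})"
      unfolding tub[OF x] using \<tau>(2)[OF x] by blast
  qed
  ultimately have "integral_curve (curve_jet 0) tube drift ?l y z"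
    unfolding integral_curve_def by blast
  moreover have "\<tau> 0 = 0" "\<tau> ?l = ?l"
    by (intro \<tau>(3); simp add: inner_real_3 flow_def curve_jet_0 curve_jet_1[unfolded One_nat_def])+
  ultimately show ?thesis
    by (intro that[of y z]) (auto simp: y_def z_def flow_def)
qed

lemma is_poincare_map_return_map: "is_poincare_map osculating (curve_jet 0) (2 * pi) return_map"
proof -
  have "asymptotic_field_near osculating (curve_jet 0) tube drift"
    unfolding asymptotic_field_near_def curve_deriv_eq_curve_jet
    using open_tube curve_in_tube continuous_on_drift asymptotic_direction_drift
    by (auto simp: drift_along_curve intro: exI[of _ 1])
  moreover have "\<forall>\<^sub>F p in nhds 0. \<exists>y z. integral_curve (curve_jet 0) tube drift (2 * pi) y z \<and>
      vector [y 0, z 0] = p \<and> return_map p = vector [y (2 * pi), z (2 * pi)]"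
  proof -
    define f where "f = (\<lambda>p::real^2. (radial_parameter (p $ 1), vertical_parameter (p $ 1) (p $ 2)))"
    have "isCont f 0"
      unfolding f_def radial_parameter_def vertical_parameter_def by (intro continuous_intros) auto
    then have "filterlim f (nhds (f 0)) (nhds 0)"
      unfolding isCont_def tendsto_at_iff_tendsto_nhds .
    then have "filterlim f (nhds (0, 0)) (nhds 0)"
      by (simp add: f_def radial_parameter_def vertical_parameter_def)
    from eventually_compose_filterlim[OF eventually_flow_close[of "1 / 32000"] this]
    have "\<forall>\<^sub>F p::real^2 in nhds 0. \<bar>radial_parameter (p $ 1)\<bar> \<le> 1 / 12 \<and> (\<forall>t\<in>{- 1..9}.
      norm (flow (radial_parameter (p $ 1)) (vertical_parameter (p $ 1) (p $ 2)) t - curve_jet 0 t) < 1 / 32000 \<and>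
      norm (drift (flow (radial_parameter (p $ 1)) (vertical_parameter (p $ 1) (p $ 2)) t) - curve_jet 1 t) < 1 / 32000)"
      by (simp add: f_def)
    moreover have "\<forall>\<^sub>F p::real^2 in nhds 0. p $ 1 < 1"
    proof -
      have "open {p::real^2. p $ 1 < 1}" by (intro open_Collect_less continuous_intros)
      from eventually_nhds_in_open[OF this, of 0] show ?thesis by simp
    qed
    ultimately show ?thesis
    proof eventually_elim
      case (elim p)
      let ?c = "radial_parameter (p $ 1)" and ?w = "vertical_parameter (p $ 1) (p $ 2)"
      have g0: "orbit_radius ?c 0 = 1 - p $ 1"
        using elim by (simp add: orbit_radius_def radial_parameter_def real_sqrt_divide)
      obtain y z where yz: "integral_curve (curve_jet 0) tube drift (2 * pi) y z"
        "y 0 = 1 - orbit_radius ?c 0" "z 0 = - (?w + 11 * ((orbit_radius ?c 0)\<^sup>2 - 1))"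
        "y (2 * pi) = 1 - orbit_radius ?c (2 * pi)"
        "z (2 * pi) = - (?w * exp (2 * pi) + 11 * ((orbit_radius ?c (2 * pi))\<^sup>2 - 1))"
        using flow_integral_curve[of ?c ?w] elim by blast
      have "vector [y 0, z 0] = p"
        by (simp add: yz g0 vertical_parameter_def vec_eq_iff forall_2)
      moreover have "return_map p = vector [y (2 * pi), z (2 * pi)]"
        by (simp add: yz return_map_def)
      ultimately show ?case using yz(1) by blast
    qed
  qed
  ultimately show ?thesis unfolding is_poincare_map_def by blast
qed

text \<open>The off-diagonal entry comes from the term
  \<open>11 (\<sigma> - 1)\<close> in \<open>w\<close>.\<close>

lemma return_map_deriv:
  "(return_map has_derivative (\<lambda>v. vector [exp (- (2 * pi)) * v $ 1,
     22 * (exp (- (2 * pi)) - exp (2 * pi)) * v $ 1 + exp (2 * pi) * v $ 2])) (at 0)"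
proof -
  let ?e = "exp (- (2 * pi))"
  have c: "(radial_parameter has_real_derivative 2) (at 0)"
    unfolding radial_parameter_def[abs_def] by (auto intro!: derivative_eq_intros)
  have g: "((\<lambda>y. orbit_radius (radial_parameter y) (2 * pi)) has_real_derivative - ?e) (at 0)"
    unfolding orbit_radius_def by (auto intro!: derivative_eq_intros c simp: radial_parameter_def)
  have "((\<lambda>p::real^2. orbit_radius (radial_parameter (p $ 1)) (2 * pi)) has_derivative (\<lambda>v. - ?e * v $ 1)) (at 0)"
    using has_derivative_compose[OF has_derivative_vec_nth[OF has_derivative_ident, of 1 "at 0"]]
      g[unfolded has_field_derivative_def] by fastforce
  moreover have "orbit_radius (radial_parameter 0) (2 * pi) = 1" by (simp add: orbit_radius_def radial_parameter_def)
  ultimately show ?thesis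
    unfolding return_map_def[abs_def] vertical_parameter_def
    by (intro has_derivative_vector_2)
       (auto intro!: derivative_eq_intros simp: fun_eq_iff algebra_simps)
qed

lemma complex_eigenvalue_lower_triangular:
  assumes "complex_eigenvalue A \<mu>" "A $ 1 $ 2 = 0"
  shows "\<mu> = complex_of_real (A $ 1 $ 1) \<or> \<mu> = complex_of_real (A $ 2 $ 2)"
proof -
  obtain v where v: "v \<noteq> 0" "map_matrix complex_of_real A *v v = \<mu> *s v"
    using assms(1) unfolding complex_eigenvalue_def by blast
  have 1: "complex_of_real (A $ 1 $ 1) * v $ 1 = \<mu> * v $ 1"
    and 2: "complex_of_real (A $ 2 $ 1) * v $ 1 + complex_of_real (A $ 2 $ 2) * v $ 2 = \<mu> * v $ 2"
    using v(2) assms(2)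
    by (simp_all add: vec_eq_iff forall_2 matrix_vector_mult_def sum_2 map_matrix_def)
  show ?thesis
  proof (cases "v $ 1 = 0")
    case True
    then have "v $ 2 \<noteq> 0" using v(1) by (auto simp: vec_eq_iff forall_2)
    then show ?thesis using 2 True by simp
  next
    case False
    then show ?thesis using 1 by simp
  qed
qed

theorem theorem4p3:
  fixes \<gamma> :: "real \<Rightarrow> real^3"
  assumes "\<And>x. \<gamma> x = vector [sin x, cos x, sin x ^ 3]"
  shows "finite_type_curve \<gamma> \<and>
    (\<exists>\<xi>. plane_field \<xi> \<and> hyperbolic_closed_asymptotic_line \<xi> \<gamma> (2 * pi))"
proof -
  have \<gamma>: "\<gamma> = curve_jet 0" using assms by (simp add: fun_eq_iff curve_jet_0)
  have "closed_asymptotic_line osculating (curve_jet 0) (2 * pi)"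
    unfolding closed_asymptotic_line_def asymptotic_line_def curve_deriv_eq_curve_jet
    using finite_type_curve_jet asymptotic_direction_drift[OF curve_in_tube]
    by (auto simp: finite_type_curve_def drift_along_curve) (simp add: curve_jet_0)
  moreover have "tubular_admissible (curve_jet 0)"
  proof -
    have "sin x \<noteq> 0" if "cos x = 0" for x :: real
      using sin_cos_squared_add[of x] that by auto
    moreover have "- (cos x * cos x) - sin x * sin x = - 1" for x :: real
      using sin_cos_squared_add3[of x] by linarith
    ultimately show ?thesis
      unfolding tubular_admissible_def curve_deriv_eq_curve_jet curve_jet_1 curve_jet_2 by simp
  qed
  moreover have "\<mu> \<notin> sphere 0 1"
    if "complex_eigenvalue (matrix (frechet_derivative return_map (at 0))) \<mu>" for \<mu>
  proof -
    let ?A = "matrix (frechet_derivative return_map (at 0))"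
    have "?A $ 1 $ 2 = 0" "?A $ 1 $ 1 = exp (- (2 * pi))" "?A $ 2 $ 2 = exp (2 * pi)"
      unfolding frechet_derivative_at[OF return_map_deriv, symmetric]
      by (simp_all add: matrix_def axis_def)
    with complex_eigenvalue_lower_triangular[OF that]
    have "norm \<mu> = exp (- (2 * pi)) \<or> norm \<mu> = exp (2 * pi)" by auto
    then show ?thesis using pi_gt_zero by auto
  qed
  ultimately have "hyperbolic_closed_asymptotic_line osculating (curve_jet 0) (2 * pi)"
    unfolding hyperbolic_closed_asymptotic_line_def
    using curve_not_parabolic is_poincare_map_return_map return_map_deriv
    by (blast intro: differentiableI)
  then show ?thesis using finite_type_curve_jet plane_field_osculating unfolding \<gamma> by blast
qed

end
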